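(* Suppose that $q=0$ or $q\ge2$ is an integer, and let $E=2\cos\pi k\in S_q$. Let $$\mathcal C(E)=\mathcal C(k)=\begin{cases}\dfrac{\sin\pi k}{A_0},& k\notin\mathbb Q\ (q=0),\\[2mm] \dfrac{\sin\pi k}{A_q},& q\ge2\text{ even},\\[2mm] \dfrac{\sin\pi k}{B_q},& q\ge3\text{ odd}.\end{cases}$$ Then for any prescribed boundary condition $u(1)\cos\varphi-u(0)\sin\varphi=0$ there exists a real-valued potential $V$ satisfying $$\limsup_{n\to\infty}|nV(n)|=\mathcal C(E)$$ such that $E$ is an eigenvalue of $\Delta+V$ with this boundary condition.
   Context: $\mathbb N=\{1,2,3,\dots\}$. For a real-valued potential $V$ with $V(n)=O(1)/(1+n)$, the discrete Schr\"odinger operator $\Delta+V$ on $\ell^2(\mathbb N)$ is $((\Delta+V)u)(n)=u(n+1)+u(n-1)+V(n)u(n)$, $n\in\mathbb N$, with a boundary condition $u(1)\cos\varphi-u(0)\sin\varphi=0$ for some real $\varphi$. $E$ is an eigenvalue of $\Delta+V$ if there is a not identically zero $u:\{0,1,2,\dots\}\to\mathbb R$ satisfying $u(n+1)+u(n-1)+V(n)u(n)=Eu(n)$ for all $n\ge1$, the boundary condition, and $\sum_n|u(n)|^2<\infty$. Every $E\in(-2,2)$ is written $E=2\cos\pi k$ with $k\in(0,1)$. Define $S_0=\{2\cos\pi k: k\in(0,1)\setminus\mathbb Q\}$ and, for $q\ge2$, $S_q=\{2\cos\pi k: k=\frac pq,\ 1\le p\le q-1,\ \gcd(p,q)=1\}$.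 Constants: $A_0=\frac2\pi$; $A_q=\dfrac{2}{q\sin\frac\pi q}$ for even $q\ge2$; $B_q=\dfrac{1+\cos\frac\pi q}{q\sin\frac\pi q}$ for odd $q\ge3$. *)

theory Defs
  imports Complex_Main "HOL-Library.Extended_Real" "HOL-Library.Landau_Symbols"
begin

text \<open>
  Potentials live on the sites 1, 2, 3, ... and are functions \<^term>\<open>V :: nat \<Rightarrow> real\<close>, whose value
  at 0 is never used.  Solutions u live on the sites 0, 1, 2, ....
\<close>

text \<open>\<open>schroedinger V u n\<close> is the value at n of (Delta + V) u; it is meaningful for n \<ge> 1 only.\<close>

definition schroedinger :: "(nat \<Rightarrow> real) \<Rightarrow> (nat \<Rightarrow> real) \<Rightarrow> nat \<Rightarrow> real" where
  "schroedinger V u n = u (n + 1) + u (n - 1) + V n * u n"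

definition boundary_condition :: "real \<Rightarrow> (nat \<Rightarrow> real) \<Rightarrow> bool" where
  "boundary_condition \<phi> u \<longleftrightarrow> u 1 * cos \<phi> - u 0 * sin \<phi> = 0"

definition is_eigenvalue :: "(nat \<Rightarrow> real) \<Rightarrow> real \<Rightarrow> real \<Rightarrow> bool" where
  "is_eigenvalue V \<phi> E \<longleftrightarrow>
     (\<exists>u :: nat \<Rightarrow> real.
        (\<exists>n. u n \<noteq> 0) \<and>
        (\<forall>n\<ge>1. schroedinger V u n = E * u n) \<and>
        boundary_condition \<phi> u \<and>
        summable (\<lambda>n. \<bar>u n\<bar>\<^sup>2))"

text \<open>For q = 1 the set below is empty.\<close>

definition energy_set :: "nat \<Rightarrow> real set" where
  "energy_set q =
     (if q = 0 then {2 * cos (pi * k) | k :: real. k \<in> {0<..<1} - \<rat>}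
      else {2 * cos (pi * (real p / real q)) | p :: nat. 1 \<le> p \<and> p \<le> q - 1 \<and> gcd p q = 1})"

definition A_const :: "nat \<Rightarrow> real" where
  "A_const q = (if q = 0 then 2 / pi else 2 / (real q * sin (pi / real q)))"

definition B_const :: "nat \<Rightarrow> real" where
  "B_const q = (1 + cos (pi / real q)) / (real q * sin (pi / real q))"

text \<open>
  The index q is determined by k: it is 0 for irrational k and otherwise the denominator of k in
  lowest terms.  Hence it is passed along with k, and \<^term>\<open>even q\<close> covers q = 0.
\<close>

definition critical_const :: "nat \<Rightarrow> real \<Rightarrow> real" where
  "critical_const q k =
     (if even q then sin (pi * k) / A_const q else sin (pi * k) / B_const q)"

end

theory Submission
  imports Defs "HOL-Analysis.Kronecker_Approximation_Theorem" "HOL-Analysis.Harmonic_Numbers"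
    "HOL-Number_Theory.Cong" "HOL-Real_Asymp.Real_Asymp"
begin

text \<open>
  A potential of size \<open>c / n\<close> whose sign opposes \<open>sin (2 * \<theta>)\<close>, where \<open>\<theta>\<close> is the Pruefer angle,
  makes the squared amplitude of a solution decay like the power \<open>- c * A / sin (pi * k)\<close> of \<open>n\<close>,
  where \<open>A\<close> is the mean of \<open>\<bar>sin (2 * \<theta>)\<bar>\<close> along the orbit.  At the critical size this power is
  exactly \<open>- 1\<close>, so a factor \<open>1 + o(1)\<close> must be added to reach the summable
  \<open>1 / (n * (ln n)\<^sup>2)\<close>.

  For irrational \<open>k\<close> and for odd \<open>q\<close> the mean is, for every starting phase, asymptotically at least
  \<open>2 / pi\<close> resp. \<open>B_const q\<close>.  The extra factor is chosen by feedback: it is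
  \<open>1 + max 0 (min 1 l)\<close>, where \<open>l\<close> is the logarithm of the squared amplitude relative to the target.
  This keeps \<open>l\<close> bounded and forces its upper limit to be at most 0, so the factor tends to 1.

  For even \<open>q\<close> the constant \<open>A_const q\<close> is the maximum of the mean over all phases, and the phase
  attaining it is unstable.  There the solution is prescribed instead, as
  \<open>(sin (\<theta> n) + \<kappa> n / n) / (sqrt n * ln n)\<close> along the optimal free orbit \<open>\<theta>\<close>, and the potential is read
  off from the equation; its absolute value times \<open>n\<close> has a limit if the bounded correction \<open>\<kappa>\<close>
  solves a suitable inhomogeneous free equation.
\<close>

section \<open>Averages of the absolute sine along rotations\<close>

text \<open>Invertibility of \<open>p\<close> modulo \<open>m\<close> makes
  \<open>j \<mapsto> i + p * j\<close> a permutation of the residues, so a sum over a full period is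
  only reordered.\<close>

lemma sum_periodic_coprime:
  fixes f :: "int \<Rightarrow> real" and i p :: int and m :: nat
  assumes per: "\<And>t. f (t + int m) = f t" and cop: "coprime p (int m)" and "m > 0"
  shows "(\<Sum>j<m. f (i + p * int j)) = (\<Sum>j<m. f (int j))"
proof -
  have mult: "f (t + int m * int a) = f t" for t a
  proof (induction a)
    case (Suc a)
    have "f (t + int m * int (Suc a)) = f ((t + int m * int a) + int m)" by (simp add: algebra_simps)
    then show ?case using per Suc by metis
  qed simp
  have mod: "f (t mod int m) = f t" for t
  proof (cases "t div int m \<ge> 0")
    case True
    then show ?thesis using mult[of "t mod int m" "nat (t div int m)"] by simp
  next
    case False
    have "t mod int m = t + int m * int (nat (- (t div int m)))" using False
      by (simp add: minus_mult_div_eq_mod[symmetric])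
    then show ?thesis using mult[of t "nat (- (t div int m))"] by simp
  qed
  define g where "g j = nat ((i + p * int j) mod int m)" for j
  have g: "g ` {..<m} \<subseteq> {..<m}" using \<open>m > 0\<close> by (auto simp: g_def nat_less_iff)
  have "inj_on g {..<m}"
  proof (rule inj_onI)
    fix a b assume ab: "a \<in> {..<m}" "b \<in> {..<m}" "g a = g b"
    then have "(i + p * int a) mod int m = (i + p * int b) mod int m"
      using \<open>m > 0\<close> by (simp add: g_def eq_nat_nat_iff)
    then have "[i + p * int a = i + p * int b] (mod int m)" by (simp add: cong_def)
    then have "[p * int a = p * int b] (mod int m)" using cong_add_lcancel by blast
    then have "[int a = int b] (mod int m)" using cop cong_mult_lcancel by blast
    then show "a = b" using ab by (simp add: cong_def)
  qed
  then have bij: "bij_betw g {..<m} {..<m}"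
    by (metis bij_betw_def endo_inj_surj finite_lessThan g)
  have "(\<Sum>j<m. f (int j)) = (\<Sum>j<m. f (int (g j)))"
    by (rule sum.reindex_bij_betw[OF bij, symmetric])
  also have "\<dots> = (\<Sum>j<m. f (i + p * int j))"
    using \<open>m > 0\<close> by (intro sum.cong) (auto simp: g_def mod)
  finally show ?thesis ..
qed

text \<open>Multiplication by \<open>2 * sin h\<close> with \<open>h = pi / (2 * m)\<close>
  telescopes the sum into cosines; after \<open>m\<close> steps of length \<open>2 * h\<close> the
  phase has moved by \<open>pi\<close>, so the two end terms add up.\<close>

lemma sum_sin_arith_pi:
  fixes x :: real
  assumes "m > 0"
  shows "(\<Sum>j<m. sin (x + pi * real j / real m)) = cos (x - pi / (2 * real m)) / sin (pi / (2 * real m))"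
proof -
  define h where "h = pi / (2 * real m)"
  have tel: "(\<Sum>j<n. sin (x + 2 * h * real j)) * (2 * sin h) = cos (x - h) - cos (x - h + 2 * h * real n)" for n
  proof (induction n)
    case (Suc n)
    have "2 * sin (x + 2 * h * real n) * sin h = cos (x + 2 * h * real n - h) - cos (x + 2 * h * real n + h)"
      by (simp add: cos_diff cos_add)
    with Suc show ?case by (simp add: algebra_simps)
  qed simp
  have h: "0 < h" "h < pi" "2 * h * real m = pi" using assms by (auto simp: h_def field_simps)
  then have "sin h > 0" by (simp add: sin_gt_zero)
  moreover have "cos (x - h + pi) = - cos (x - h)" by simp
  ultimately have "(\<Sum>j<m. sin (x + 2 * h * real j)) = cos (x - h) / sin h"
    using tel[of m] h(3) by (simp add: eq_divide_eq)
  moreover have "pi * real j / real m = 2 * h * real j" for j by (simp add: h_def)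
  ultimately have "(\<Sum>j<m. sin (x + pi * real j / real m)) = cos (x - h) / sin h"
    by (simp only:)
  then show ?thesis unfolding h_def .
qed

text \<open>Modulo the period \<open>pi\<close> of the absolute sine, the phases fill a grid of
  spacing \<open>pi / m\<close>, so only the offset \<open>y\<close> in \<open>[0, pi / m]\<close>
  matters. The closed form \<open>cos (y - pi / (2 * m)) / sin (pi / (2 * m))\<close> is least at
  the ends of that interval, where it is the cotangent.\<close>

lemma sum_abs_sin_coprime_ge:
  fixes x :: real and p :: int and m :: nat
  assumes "m > 0" "coprime p (int m)"
  shows "(\<Sum>j<m. \<bar>sin (x + pi * (of_int p * real j / real m))\<bar>) \<ge> cot (pi / (2 * real m))"
proof -
  define i where "i = \<lfloor>x / (pi / real m)\<rfloor>"
  define y where "y = x - of_int i * (pi / real m)"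
  have d: "pi / real m > 0" using assms by simp
  have y: "0 \<le> y" "y \<le> pi / real m"
    using floor_divide_lower[OF d, of x] floor_divide_upper[OF d, of x]
    by (auto simp: y_def i_def algebra_simps add_divide_distrib)
  define f where "f t = \<bar>sin (y + pi * of_int t / real m)\<bar>" for t :: int
  have per: "f (t + int m) = f t" for t
  proof -
    have "y + pi * of_int (t + int m) / real m = (y + pi * of_int t / real m) + pi"
      using assms by (simp add: field_simps)
    then show ?thesis by (simp only: f_def sin_periodic_pi abs_minus_cancel)
  qed
  have "(\<Sum>j<m. \<bar>sin (x + pi * (of_int p * real j / real m))\<bar>) = (\<Sum>j<m. f (i + p * int j))"
    by (intro sum.cong refl) (simp add: f_def y_def algebra_simps add_divide_distrib)
  also have "\<dots> = (\<Sum>j<m. f (int j))"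
    using sum_periodic_coprime[of f m p i] per assms by blast
  also have "\<dots> = (\<Sum>j<m. sin (y + pi * real j / real m))"
  proof (intro sum.cong refl)
    fix j assume "j \<in> {..<m}"
    then have "pi * real j / real m + pi / real m \<le> pi"
      using mult_left_mono[of "real j + 1" "real m" "pi"] by (simp add: field_simps)
    then have "sin (y + pi * real j / real m) \<ge> 0"
      using y by (intro sin_ge_zero) auto
    then show "f (int j) = sin (y + pi * real j / real m)" by (simp add: f_def)
  qed
  also have "\<dots> = cos (y - pi / (2 * real m)) / sin (pi / (2 * real m))"
    by (rule sum_sin_arith_pi[OF assms(1)])
  also have "\<dots> \<ge> cos (pi / (2 * real m)) / sin (pi / (2 * real m))"
  proof (rule divide_right_mono)
    have "\<bar>y - pi / (2 * real m)\<bar> \<le> pi / (2 * real m)"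
      using y by (auto simp: abs_le_iff field_simps)
    moreover have "pi / (2 * real m) \<le> pi" using assms by (simp add: field_simps)
    ultimately have "cos (pi / (2 * real m)) \<le> cos \<bar>y - pi / (2 * real m)\<bar>"
      by (intro cos_monotone_0_pi_le) auto
    then show "cos (pi / (2 * real m)) \<le> cos (y - pi / (2 * real m))" by simp
    show "0 \<le> sin (pi / (2 * real m))" using assms by (intro sin_ge_zero) (auto simp: field_simps)
  qed
  finally show ?thesis by (simp add: cot_def)
qed

lemma abs_sin_diff_le: "\<bar>sin x - sin y\<bar> \<le> \<bar>x - y\<bar>" for x y :: real
proof -
  have "\<bar>sin x - sin y\<bar> = 2 * \<bar>sin ((x - y) / 2)\<bar> * \<bar>cos ((x + y) / 2)\<bar>"
    by (simp add: sin_diff_sin abs_mult)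
  also have "\<dots> \<le> 2 * \<bar>(x - y) / 2\<bar> * 1"
    by (intro mult_mono abs_sin_x_le_abs_x) auto
  finally show ?thesis by simp
qed

text \<open>Infinitely many reduced Dirichlet approximations exist, so their denominators exceed any
  bound.\<close>

lemma irrational_coprime_approx:
  fixes x :: real
  assumes "x \<notin> \<rat>"
  shows "\<exists>h m. int M < int m \<and> coprime h (int m) \<and> \<bar>x - of_int h / real m\<bar> \<le> 1 / (real m)\<^sup>2"
proof -
  have "infinite (approx_set x)" using assms rational_iff_finite_approx_set by blast
  from infinite_approx_set[OF this, of "int M"] obtain h n where
    hn: "(h, n) \<in> approx_set x" "n > int M" by auto
  then show ?thesis
    by (intro exI[of _ h] exI[of _ "nat n"]) (auto simp: approx_set_def)
qed

text \<open>Over one denominator \<open>m\<close> of a good rational approximation, each phase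
  drifts from the rational grid by at most \<open>pi / m\<close>. The grid bound thus loses at most
  \<open>pi\<close> in total, and \<open>cot (pi / (2 * m)) / m\<close> tends to
  \<open>2 / pi\<close>. The window length is fixed before the starting phase.\<close>

lemma uniform_average_abs_sin:
  fixes k \<eta> :: real
  assumes "k \<notin> \<rat>" "\<eta> > 0"
  shows "\<exists>L>0. \<forall>x. (\<Sum>j<L. \<bar>sin (x + 2 * pi * k * real j)\<bar>) \<ge> real L * (2 / pi - \<eta>)"
proof -
  have "((\<lambda>m. cot (pi / (2 * real m)) / real m - pi / real m) \<longlongrightarrow> 2 / pi) sequentially"
    unfolding cot_def by real_asymp
  then have "eventually (\<lambda>m. cot (pi / (2 * real m)) / real m - pi / real m > 2 / pi - \<eta>) sequentially"
    by (rule order_tendstoD) (use assms in auto)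
  then obtain M where M: "\<And>m. m \<ge> M \<Longrightarrow> cot (pi / (2 * real m)) / real m - pi / real m > 2 / pi - \<eta>"
    by (auto simp: eventually_sequentially)
  have "2 * k \<notin> \<rat>"
  proof
    assume "2 * k \<in> \<rat>"
    then have "2 * k / 2 \<in> \<rat>" by (intro Rats_divide) auto
    with assms show False by simp
  qed
  \<comment> \<open>Approximating \<open>2 * k\<close> instead of \<open>k\<close> makes the parity of the denominator irrelevant,
    because \<open>\<bar>sin\<bar>\<close> has period \<open>pi\<close>.\<close>
  from irrational_coprime_approx[OF this, of M] obtain h m where
    m: "M < m" "coprime h (int m)" "\<bar>2 * k - of_int h / real m\<bar> \<le> 1 / (real m)\<^sup>2" by auto
  show ?thesis
  proof (intro exI conjI allI)
    show "m > 0" using m by simp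
    fix x
    have term_le: "\<bar>sin (x + 2 * pi * k * real j)\<bar> \<ge> \<bar>sin (x + pi * (of_int h * real j / real m))\<bar> - pi / real m"
      if "j < m" for j
    proof -
      have "\<bar>sin (x + 2 * pi * k * real j) - sin (x + pi * (of_int h * real j / real m))\<bar>
          \<le> \<bar>(x + 2 * pi * k * real j) - (x + pi * (of_int h * real j / real m))\<bar>"
        by (rule abs_sin_diff_le)
      also have "\<dots> = pi * real j * \<bar>2 * k - of_int h / real m\<bar>"
      proof -
        have "(x + 2 * pi * k * real j) - (x + pi * (of_int h * real j / real m))
            = (pi * real j) * (2 * k - of_int h / real m)" by (simp add: algebra_simps)
        then show ?thesis by (simp only: abs_mult) simp
      qed
      also have "\<dots> \<le> pi * real m * (1 / (real m)\<^sup>2)"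
        using m that by (intro mult_mono) auto
      also have "\<dots> = pi / real m" by (simp add: power2_eq_square)
      finally show ?thesis by linarith
    qed
    show "real m * (2 / pi - \<eta>) \<le> (\<Sum>j<m. \<bar>sin (x + 2 * pi * k * real j)\<bar>)"
    proof -
      have "(\<Sum>j<m. \<bar>sin (x + pi * (of_int h * real j / real m))\<bar> - pi / real m)
          \<le> (\<Sum>j<m. \<bar>sin (x + 2 * pi * k * real j)\<bar>)"
        using term_le by (intro sum_mono) auto
      moreover have "cot (pi / (2 * real m)) \<le> (\<Sum>j<m. \<bar>sin (x + pi * (of_int h * real j / real m))\<bar>)"
        using m by (intro sum_abs_sin_coprime_ge) auto
      ultimately have "cot (pi / (2 * real m)) - pi \<le> (\<Sum>j<m. \<bar>sin (x + 2 * pi * k * real j)\<bar>)"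
        using m(1) by (simp add: sum_subtractf)
      moreover have "real m * (2 / pi - \<eta>) \<le> real m * (cot (pi / (2 * real m)) / real m - pi / real m)"
        using M[of m] m(1) by (intro mult_left_mono) auto
      ultimately show ?thesis using m(1) by (simp add: right_diff_distrib)
    qed
  qed
qed

section \<open>Sequences driven by clamped feedback\<close>

text \<open>Truncation keeps the feedback factor \<open>1 + unit_clamp l\<close> between 1 and 2, so
  the potential is of order \<open>1 / n\<close> whatever the solution does; the Lipschitz property
  allows freezing the factor over a short window.\<close>

definition unit_clamp :: "real \<Rightarrow> real" where
  "unit_clamp x = max 0 (min 1 x)"

lemma unit_clamp_bounds: "0 \<le> unit_clamp x" "unit_clamp x \<le> 1"
  by (auto simp: unit_clamp_def)

lemma unit_clamp_lipschitz: "\<bar>unit_clamp x - unit_clamp y\<bar> \<le> \<bar>x - y\<bar>"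
  by (auto simp: unit_clamp_def)

lemma shift_diff_tendsto_0:
  fixes l :: "nat \<Rightarrow> real"
  assumes "(\<lambda>n. l (Suc n) - l n) \<longlonglongrightarrow> 0"
  shows "(\<lambda>n. l (n + j) - l n) \<longlonglongrightarrow> 0"
proof (induction j)
  case (Suc j)
  have "(\<lambda>n. (l (Suc (n + j)) - l (n + j)) + (l (n + j) - l n)) \<longlonglongrightarrow> 0 + 0"
    by (intro tendsto_add Suc LIMSEQ_ignore_initial_segment[OF assms, of j])
  then show ?case by simp
qed simp

text \<open>As long as \<open>l\<close> exceeds \<open>2 * a\<close>, the losses along blocks of
  length \<open>L\<close> add up like a harmonic series, so \<open>l\<close> must come down.
  Afterwards a block starting above \<open>2 * a\<close> does not increase and one starting lower
  gains less than \<open>a\<close>: block ends stay below \<open>3 * a\<close>, intermediate points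
  below \<open>4 * a\<close>.\<close>

lemma block_descent_imp_limsup_nonpos:
  fixes l :: "nat \<Rightarrow> real"
  assumes diff: "(\<lambda>n. l (Suc n) - l n) \<longlonglongrightarrow> 0"
    and block: "\<And>a. a > 0 \<Longrightarrow> \<exists>L>0. \<forall>\<^sub>F n in sequentially.
                  l (n + L) \<le> l n - real L / real n * (unit_clamp (l n) - a)"
    and "\<eta> > 0"
  shows "\<forall>\<^sub>F n in sequentially. l n \<le> \<eta>"
proof -
  \<comment> \<open>The bound \<open>1 / 4\<close> keeps \<open>2 * a\<close> below the saturation
    level 1 of the clamp, so that \<open>l n > 2 * a\<close> leaves a net descent rate of at least
    \<open>a\<close>.\<close>
  define a where "a = min (\<eta> / 4) (1 / 4)"
  have a: "0 < a" "a \<le> 1/4" "4 * a \<le> \<eta>" using \<open>\<eta> > 0\<close> by (auto simp: a_def)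
  obtain L where "L > 0" and L: "\<forall>\<^sub>F n in sequentially.
      l (n + L) \<le> l n - real L / real n * (unit_clamp (l n) - a)"
    using block[OF a(1)] by auto
  have "\<forall>\<^sub>F n in sequentially. \<forall>j\<in>{..L}. \<bar>l (n + j) - l n\<bar> < a"
  proof (rule eventually_ball_finite)
    show "\<forall>j\<in>{..L}. \<forall>\<^sub>F n in sequentially. \<bar>l (n + j) - l n\<bar> < a"
      using tendstoD[OF shift_diff_tendsto_0[OF diff] a(1)] by (simp add: dist_real_def)
  qed simp
  with L have "\<forall>\<^sub>F n in sequentially. n \<ge> L \<and>
      l (n + L) \<le> l n - real L / real n * (unit_clamp (l n) - a) \<and>
      (\<forall>j\<le>L. \<bar>l (n + j) - l n\<bar> < a)"
    using eventually_ge_at_top[of L] by eventually_elim auto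
  then obtain N where N: "\<And>n. n \<ge> N \<Longrightarrow> n \<ge> L"
      "\<And>n. n \<ge> N \<Longrightarrow> l (n + L) \<le> l n - real L / real n * (unit_clamp (l n) - a)"
      "\<And>n j. n \<ge> N \<Longrightarrow> j \<le> L \<Longrightarrow> \<bar>l (n + j) - l n\<bar> < a"
    unfolding eventually_sequentially by blast
  have "N > 0" using N(1)[of N] \<open>L > 0\<close> by simp
  have dec: "l (n + L) \<le> l n - a * (real L / real n)" if "n \<ge> N" "l n > 2 * a" for n
  proof -
    have "unit_clamp (l n) - a \<ge> a" using that a by (auto simp: unit_clamp_def)
    then have "real L / real n * a \<le> real L / real n * (unit_clamp (l n) - a)"
      by (intro mult_left_mono) auto
    with N(2)[OF that(1)] show ?thesis by (simp add: mult.commute)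
  qed
  have "\<exists>n0\<ge>N. l n0 \<le> 2 * a"
  proof (rule ccontr)
    assume "\<not> ?thesis"
    then have gt: "l n > 2 * a" if "n \<ge> N" for n using that by force
    have le: "l (N + i * L) \<le> l N - a / real N * (\<Sum>j<i. 1 / real (Suc j))" for i
    proof (induction i)
      case (Suc i)
      \<comment> \<open>This crude comparison makes each block loss at least a fixed multiple of
        \<open>1 / (i + 1)\<close>. As \<open>l\<close> stays positive, the harmonic sums would be
        bounded.\<close>
      have "real (N + i * L) \<le> real L * (real N * real (Suc i))"
      proof -
        have "N + i * L \<le> L * N + (L * i) * N"
          using \<open>L > 0\<close> \<open>N > 0\<close> by (intro add_mono) (auto simp: mult.commute)
        then have "N + i * L \<le> L * (N * Suc i)" by (simp add: algebra_simps)
        then show ?thesis by (metis of_nat_le_iff of_nat_mult)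
      qed
      moreover have "0 < real (N + i * L)" using \<open>N > 0\<close> by (simp only: of_nat_0_less_iff)
      ultimately have "real L / (real L * (real N * real (Suc i))) \<le> real L / real (N + i * L)"
        by (intro frac_le) auto
      then have "1 / (real N * real (Suc i)) \<le> real L / real (N + i * L)"
        using \<open>L > 0\<close> by simp
      then have "a * (1 / (real N * real (Suc i))) \<le> a * (real L / real (N + i * L))"
        using a by (intro mult_left_mono) auto
      moreover have "l (N + i * L + L) \<le> l (N + i * L) - a * (real L / real (N + i * L))"
        by (intro dec gt) auto
      moreover have "N + Suc i * L = N + i * L + L" by simp
      moreover have "a / real N * (\<Sum>j<Suc i. 1 / real (Suc j))
          = a / real N * (\<Sum>j<i. 1 / real (Suc j)) + a * (1 / (real N * real (Suc i)))"
        by (simp only: sum.lessThan_Suc distrib_left) simp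
      ultimately show ?case using Suc by (simp only:)
    qed simp
    have "(\<Sum>j<i. 1 / real (Suc j)) \<le> real N / a * l N" for i
    proof -
      have "a / real N * (\<Sum>j<i. 1 / real (Suc j)) \<le> l N"
        using le[of i] gt[of "N + i * L"] a by simp
      then show ?thesis using a \<open>N > 0\<close> by (simp add: field_simps)
    qed
    then have "summable (\<lambda>j. 1 / real (Suc j))"
      by (intro summableI_nonneg_bounded) auto
    then show False using not_summable_harmonic[where 'a = real]
      by (subst (asm) summable_Suc_iff) (simp add: inverse_eq_divide)
  qed
  then obtain n0 where n0: "n0 \<ge> N" "l n0 \<le> 2 * a" by blast
  have ind: "l (n0 + i * L) \<le> 3 * a" for i
  proof (induction i)
    case (Suc i)
    define n where "n = n0 + i * L"
    have n: "n \<ge> N" "l n \<le> 3 * a" using n0 Suc by (auto simp: n_def)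
    have "l (n + L) \<le> 3 * a"
    proof (cases "l n > 2 * a")
      case True
      have "0 \<le> a * (real L / real n)" using a by simp
      with dec[OF n(1) True] n(2) show ?thesis by linarith
    next
      case False
      with N(3)[OF n(1), of L] show ?thesis by simp
    qed
    then show ?case by (simp add: n_def add_ac)
  qed (use n0 a in simp)
  have "l n \<le> \<eta>" if "n \<ge> n0" for n
  proof -
    define i j where "i = (n - n0) div L" and "j = (n - n0) mod L"
    have n: "n = (n0 + i * L) + j" "j \<le> L"
      using that \<open>L > 0\<close> by (auto simp: i_def j_def less_imp_le)
    have "\<bar>l (n0 + i * L + j) - l (n0 + i * L)\<bar> < a"
      using n0 n by (intro N(3)) auto
    with ind[of i] a n show ?thesis by simp
  qed
  then show ?thesis by (auto simp: eventually_sequentially)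
qed

text \<open>Over a window of fixed length the weight \<open>1 / n\<close> and the clamp value
  \<open>d\<close> are almost constant, so \<open>g\<close> may be replaced by its mean, at least
  \<open>A\<close> up to a small error. Since \<open>c * A = 1\<close>, the critical terms cancel
  and the mean drift is at most \<open>- d\<close> plus a small error.\<close>

lemma feedback_limsup_nonpos:
  fixes l g e :: "nat \<Rightarrow> real" and c A :: real
  assumes step: "\<forall>\<^sub>F n in sequentially.
      l (Suc n) \<le> l n + (1 - c * (1 + unit_clamp (l n)) * g n + e n) / real n"
    and diff: "(\<lambda>n. l (Suc n) - l n) \<longlonglongrightarrow> 0"
    and g: "\<And>n. 0 \<le> g n" "\<And>n. g n \<le> 1"
    and e: "e \<longlonglongrightarrow> 0"
    and cA: "c > 0" "c * A = 1"
    and avg: "\<And>\<eta>. \<eta> > 0 \<Longrightarrow> \<exists>L>0. \<forall>\<^sub>F n in sequentially. (\<Sum>j<L. g (n + j)) \<ge> real L * (A - \<eta>)"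
    and "\<eta> > 0"
  shows "\<forall>\<^sub>F n in sequentially. l n \<le> \<eta>"
proof (rule block_descent_imp_limsup_nonpos[OF diff _ \<open>\<eta> > 0\<close>])
  fix a :: real assume "a > 0"
  define d where "d n = unit_clamp (l n)" for n
  have d: "0 \<le> d n" "d n \<le> 1" for n by (auto simp: d_def unit_clamp_bounds)
  \<comment> \<open>As \<open>c * (1 + d n) \<le> 2 * c\<close>, the tolerance
    \<open>a / (4 * c)\<close> costs at most \<open>a / 2\<close> per site; the other
    \<open>a / 2\<close> is reserved for the errors \<open>t\<close>.\<close>
  obtain L where "L > 0" and L: "\<forall>\<^sub>F n in sequentially. (\<Sum>j<L. g (n + j)) \<ge> real L * (A - a / (4 * c))"
    using avg[of "a / (4 * c)"] \<open>a > 0\<close> cA by auto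
  define B where "B n = 1 - c * (1 + d n) * g n" for n
  have B: "\<bar>B n\<bar> \<le> 1 + 2 * c" for n
  proof -
    have "0 \<le> c * (1 + d n) * g n" "c * (1 + d n) * g n \<le> c * 2 * 1"
      using cA d[of n] g[of n] mult_mono[of "1 + d n" 2 "g n" 1] by (auto simp: mult.assoc)
    then show ?thesis by (simp add: B_def abs_le_iff)
  qed
  \<comment> \<open>The error, scaled by \<open>n\<close>, of replacing \<open>1 / (n + j)\<close>
    by \<open>1 / n\<close>, freezing the clamp at site \<open>n\<close> and dropping
    \<open>e\<close>.\<close>
  define t where "t j n = real n / real (n + j) * (B (n + j) + e (n + j)) - (1 - c * (1 + d n) * g (n + j))" for j n
  have t: "t j \<longlonglongrightarrow> 0" for j
  proof (rule Lim_null_comparison)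
    let ?r = "\<lambda>n. real n / real (n + j)"
    have r: "?r \<longlonglongrightarrow> 1" by real_asymp
    show "(\<lambda>n. \<bar>?r n - 1\<bar> * (1 + 2 * c) + \<bar>?r n\<bar> * \<bar>e (n + j)\<bar> + c * \<bar>l (n + j) - l n\<bar>) \<longlonglongrightarrow> 0"
    proof -
      have "(\<lambda>n. \<bar>?r n - 1\<bar> * (1 + 2 * c) + \<bar>?r n\<bar> * \<bar>e (n + j)\<bar> + c * \<bar>l (n + j) - l n\<bar>)
          \<longlonglongrightarrow> \<bar>1 - 1\<bar> * (1 + 2 * c) + \<bar>1\<bar> * \<bar>0\<bar> + c * \<bar>0\<bar>"
        by (intro tendsto_intros tendsto_rabs r LIMSEQ_ignore_initial_segment[OF e]
            shift_diff_tendsto_0[OF diff])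
      then show ?thesis by (simp only: diff_self abs_zero mult_zero_left mult_zero_right add_0)
    qed
    show "\<forall>\<^sub>F n in sequentially. norm (t j n) \<le>
       \<bar>?r n - 1\<bar> * (1 + 2 * c) + \<bar>?r n\<bar> * \<bar>e (n + j)\<bar> + c * \<bar>l (n + j) - l n\<bar>"
    proof (intro always_eventually allI)
      fix n
      have "t j n = (?r n - 1) * B (n + j) + ?r n * e (n + j) + c * ((d n - d (n + j)) * g (n + j))"
        by (simp add: t_def B_def algebra_simps add_divide_distrib)
      also have "\<bar>\<dots>\<bar> \<le> \<bar>?r n - 1\<bar> * \<bar>B (n + j)\<bar> + \<bar>?r n\<bar> * \<bar>e (n + j)\<bar> + c * (\<bar>d n - d (n + j)\<bar> * \<bar>g (n + j)\<bar>)"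
        using cA by (intro order.trans[OF abs_triangle_ineq] add_mono) (auto simp: abs_mult)
      also have "\<dots> \<le> \<bar>?r n - 1\<bar> * (1 + 2 * c) + \<bar>?r n\<bar> * \<bar>e (n + j)\<bar> + c * (\<bar>l (n + j) - l n\<bar> * 1)"
        using cA B g unit_clamp_lipschitz[of "l (n + j)" "l n"]
        by (intro add_mono mult_left_mono mult_mono) (auto simp: d_def abs_minus_commute)
      finally show "norm (t j n) \<le> \<bar>?r n - 1\<bar> * (1 + 2 * c) + \<bar>?r n\<bar> * \<bar>e (n + j)\<bar> + c * \<bar>l (n + j) - l n\<bar>"
        by simp
    qed
  qed
  have "(\<lambda>n. \<Sum>j<L. t j n) \<longlonglongrightarrow> (\<Sum>j<L. 0)" by (intro tendsto_sum t)
  then have ev_t: "\<forall>\<^sub>F n in sequentially. (\<Sum>j<L. t j n) < real L * a / 2"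
    by (rule order_tendstoD(2)) (use \<open>L > 0\<close> \<open>a > 0\<close> in simp)
  obtain N where N: "\<And>n. n \<ge> N \<Longrightarrow> l (Suc n) \<le> l n + (B n + e n) / real n"
    using step by (auto simp: eventually_sequentially B_def d_def)
  have tel: "l (n + i) \<le> l n + (\<Sum>j<i. (B (n + j) + e (n + j)) / real (n + j))" if "n \<ge> N" for n i
  proof (induction i)
    case (Suc i)
    with N[of "n + i"] that show ?case by simp
  qed simp
  have "\<forall>\<^sub>F n in sequentially. l (n + L) \<le> l n - real L / real n * (unit_clamp (l n) - a)"
    using L ev_t eventually_ge_at_top[of N] eventually_gt_at_top[of 0]
  proof eventually_elim
    case (elim n)
    have "(\<Sum>j<L. (B (n + j) + e (n + j)) / real (n + j)) = (\<Sum>j<L. (t j n + (1 - c * (1 + d n) * g (n + j))) / real n)"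
    proof (intro sum.cong refl)
      fix j
      have "t j n + (1 - c * (1 + d n) * g (n + j)) = real n / real (n + j) * (B (n + j) + e (n + j))"
        unfolding t_def by (rule diff_add_cancel)
      then show "(B (n + j) + e (n + j)) / real (n + j) = (t j n + (1 - c * (1 + d n) * g (n + j))) / real n"
        using elim by simp
    qed
    also have "\<dots> = ((\<Sum>j<L. t j n) + real L - c * (1 + d n) * (\<Sum>j<L. g (n + j))) / real n"
      by (simp add: sum_divide_distrib[symmetric] sum.distrib sum_subtractf sum_distrib_left)
    also have "\<dots> \<le> (real L * a / 2 + real L - real L * (1 + d n) + real L * a / 2) / real n"
    proof (rule divide_right_mono)
      have "c * (1 + d n) * (real L * (A - a / (4 * c))) \<le> c * (1 + d n) * (\<Sum>j<L. g (n + j))"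
        using elim cA d[of n] by (intro mult_left_mono) auto
      moreover have "c * (1 + d n) * (real L * (A - a / (4 * c)))
          = real L * (1 + d n) * (c * A) - real L * (1 + d n) * a / 4"
        using cA(1) by (simp add: field_simps)
      moreover have "real L * (1 + d n) * a / 4 \<le> real L * 2 * a / 4"
        using d[of n] \<open>a > 0\<close> by (intro divide_right_mono mult_right_mono mult_left_mono) auto
      ultimately show "(\<Sum>j<L. t j n) + real L - c * (1 + d n) * (\<Sum>j<L. g (n + j))
        \<le> real L * a / 2 + real L - real L * (1 + d n) + real L * a / 2"
        using elim(2) unfolding cA(2) by linarith
    qed simp
    also have "\<dots> = - (real L / real n * (d n - a))" using elim by (simp add: field_simps)
    finally show ?case using tel[OF elim(3), of L] by (simp add: d_def)
  qed
  then show "\<exists>L>0. \<forall>\<^sub>F n in sequentially. l (n + L) \<le> l n - real L / real n * (unit_clamp (l n) - a)"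
    using \<open>L > 0\<close> by (intro exI[of _ L] conjI)
qed

section \<open>Decay by feedback\<close>

text \<open>The differences of consecutive values of \<open>1 / ln n\<close> telescope to a
  convergent series and dominate these terms up to a constant factor.\<close>

lemma summable_inverse_n_ln_squared: "summable (\<lambda>n. 1 / (real n * (ln (real n))\<^sup>2))"
proof (rule summable_comparison_test_bigo)
  have "(\<lambda>n. - 1 / ln (real (Suc n)) - - 1 / ln (real n)) sums (0 - - 1 / ln (real 0))"
    by (rule telescope_sums) real_asymp
  then have "summable (\<lambda>n. - 1 / ln (real (Suc n)) - - 1 / ln (real n))"
    by (rule sums_summable)
  \<comment> \<open>From index 2 on, \<open>1 / ln n\<close> is positive and decreasing, so norms
    can be inserted; the shift avoids \<open>ln 1 = 0\<close>.\<close>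
  then have "summable (\<lambda>n. norm (- 1 / ln (real (n + 2 + 1)) - - 1 / ln (real (n + 2))))"
    by (subst (asm) summable_iff_shift[symmetric, of _ 2])
      (simp add: frac_le)
  then have "summable (\<lambda>n. norm (- 1 / ln (real (n + 1)) - - 1 / ln (real n)))"
    by (subst summable_iff_shift[symmetric, of _ 2]) (simp add: add_ac)
  then show "summable (\<lambda>n. norm (1 / ln (real n) - 1 / ln (real n + 1)))"
    by (simp add: add_ac)
  show "(\<lambda>n. 1 / (real n * (ln (real n))\<^sup>2)) \<in> O(\<lambda>n. 1 / ln (real n) - 1 / ln (real n + 1))"
    by real_asymp
qed

text \<open>The potential \<open>F\<close> may depend on the two latest values of the solution, so
  potential and solution are generated together, as feedback requires.\<close>

lemma recurrence_exists:
  fixes F :: "nat \<Rightarrow> real \<Rightarrow> real \<Rightarrow> real" and E a b :: real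
  obtains u :: "nat \<Rightarrow> real" where "u 0 = a" "u 1 = b"
    "\<And>n. n \<ge> 1 \<Longrightarrow> u (n + 1) = (E - F n (u n) (u (n - 1))) * u n - u (n - 1)"
proof -
  define p where "p = rec_nat (a, b) (\<lambda>n (x, y). (y, (E - F (Suc n) y x) * y - x))"
  have p: "p 0 = (a, b)" "p (Suc n) = (snd (p n), (E - F (Suc n) (snd (p n)) (fst (p n))) * snd (p n) - fst (p n))" for n
    by (simp_all add: p_def case_prod_unfold)
  show ?thesis
  proof (rule that[of "\<lambda>n. fst (p n)"])
    fix n :: nat assume "n \<ge> 1"
    then obtain m where "n = Suc m" by (cases n) auto
    then show "fst (p (n + 1)) = (E - F n (fst (p n)) (fst (p (n - 1)))) * fst (p n) - fst (p (n - 1))"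
      by (simp add: p)
  qed (simp_all add: p)
qed

text \<open>The difference splits into \<open>a - b\<close> scaled by \<open>1 / norm b\<close> and
  a radial correction of \<open>a\<close>; each part is at most
  \<open>norm (a - b) / norm b\<close>. This bounds the phase error caused by a
  perturbation.\<close>

lemma norm_sgn_diff_le:
  fixes a b :: "'a :: real_normed_vector"
  assumes "a \<noteq> 0" "b \<noteq> 0"
  shows "norm (sgn a - sgn b) \<le> 2 * norm (a - b) / norm b"
proof -
  have "sgn a - sgn b = (1 / norm b) *\<^sub>R (a - b) + (1 / norm a - 1 / norm b) *\<^sub>R a"
    by (simp add: sgn_div_norm scaleR_diff_right scaleR_diff_left inverse_eq_divide)
  also have "norm \<dots> \<le> norm (a - b) / norm b + \<bar>norm b - norm a\<bar> / norm b"
  proof (rule order.trans[OF norm_triangle_ineq] , rule add_mono)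
    have "norm ((1 / norm a - 1 / norm b) *\<^sub>R a) = \<bar>(1 / norm a - 1 / norm b) * norm a\<bar>"
      by (simp add: abs_mult)
    also have "(1 / norm a - 1 / norm b) * norm a = (norm b - norm a) / norm b"
      using assms by (simp add: field_simps)
    finally show "norm ((1 / norm a - 1 / norm b) *\<^sub>R a) \<le> \<bar>norm b - norm a\<bar> / norm b" by simp
  qed simp
  also have "\<dots> \<le> norm (a - b) / norm b + norm (a - b) / norm b"
    using norm_triangle_ineq3[of b a] by (intro add_mono divide_right_mono) (auto simp: norm_minus_commute)
  finally show ?thesis by simp
qed

lemma bigo_limsup_of_scaled_limit:
  fixes V :: "nat \<Rightarrow> real"
  assumes "(\<lambda>n. \<bar>real n * V n\<bar>) \<longlonglongrightarrow> C"
  shows "V \<in> O(\<lambda>n. 1 / (1 + real n))" "limsup (\<lambda>n. ereal \<bar>real n * V n\<bar>) = ereal C"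
proof -
  have "(\<lambda>n. real n * V n) \<in> O(\<lambda>_. 1)"
  proof -
    have "(\<lambda>n. \<bar>real n * V n\<bar>) \<in> O(\<lambda>_. 1)"
      using assms by (intro bigoI_tendsto[where c = C]) simp_all
    then show ?thesis by simp
  qed
  then have "(\<lambda>n. inverse (real n) * (real n * V n)) \<in> O(\<lambda>n. inverse (real n) * 1)"
    by (intro landau_o.big.mult) auto
  also have "(\<lambda>n. inverse (real n) * 1) \<in> O(\<lambda>n. 1 / (1 + real n))" by real_asymp
  also have "(\<lambda>n. inverse (real n) * (real n * V n)) \<in> O(\<lambda>n. 1 / (1 + real n))
      \<longleftrightarrow> V \<in> O(\<lambda>n. 1 / (1 + real n))"
    by (intro landau_o.big.in_cong eventually_mono[OF eventually_gt_at_top[of 0]]) auto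
  finally show "V \<in> O(\<lambda>n. 1 / (1 + real n))" .
  have "(\<lambda>n. ereal \<bar>real n * V n\<bar>) \<longlonglongrightarrow> ereal C"
    using assms by (intro tendsto_ereal)
  then show "limsup (\<lambda>n. ereal \<bar>real n * V n\<bar>) = ereal C"
    by (intro lim_imp_Limsup) simp_all
qed

text \<open>The potential moves the phase by only O(1/n) per step, so over a fixed window the orbit
  follows a free rotation. Because \<open>avg\<close> holds for every starting phase, the phase
  needs no control and only the amplitude is fed back.\<close>

lemma greedy_eigenvalue:
  fixes k A \<phi> :: real
  assumes k: "0 < k" "k < 1" and A: "A > 0"
    and avg: "\<And>\<eta>. \<eta> > 0 \<Longrightarrow> \<exists>L>0. \<forall>x. (\<Sum>j<L. \<bar>sin (x + 2 * pi * k * real j)\<bar>) \<ge> real L * (A - \<eta>)"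
  shows "\<exists>V. (\<lambda>n. \<bar>real n * V n\<bar>) \<longlonglongrightarrow> sin (pi * k) / A \<and> is_eigenvalue V \<phi> (2 * cos (pi * k))"
proof -
  define s where "s = sin (pi * k)"
  define co where "co = cos (pi * k)"
  define E where "E = 2 * co"
  define c where "c = 1 / A"
  have c: "c > 0" "c * A = 1" using A by (auto simp: c_def)
  have s: "s > 0" using k by (auto simp: s_def intro!: sin_gt_zero)
  have sc: "s\<^sup>2 + co\<^sup>2 = 1" by (simp add: s_def co_def)
  \<comment> \<open>In the coordinates \<open>Y + i u\<close> one step is the shear \<open>Y \<mapsto> Y - w * u\<close> followed by the rotation
    by \<open>pi * k\<close>.  The sign of the potential always decreases the norm, and its size is increased
    whenever the squared norm exceeds the target \<open>1 / (n * (ln n)\<^sup>2)\<close>.\<close>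
  define Yf where "Yf b a = (b * co - a) / s" for b a
  define lf where "lf n b a = ln (b\<^sup>2 + (Yf b a)\<^sup>2) + ln (real n) + 2 * ln (ln (real n))" for n b a
  \<comment> \<open>Where the product vanishes the sign is set to 1, not 0, so that the absolute
    value of the potential has the prescribed size at every site.\<close>
  define F where "F n b a = s * c * (1 + unit_clamp (lf n b a)) / real n * (if b * Yf b a \<ge> 0 then 1 else -1)" for n b a
  obtain u where u: "u 0 = cos \<phi>" "u 1 = sin \<phi>"
    "\<And>n. n \<ge> 1 \<Longrightarrow> u (n + 1) = (E - F n (u n) (u (n - 1))) * u n - u (n - 1)"
    using recurrence_exists[of "cos \<phi>" "sin \<phi>" E F] by blast
  define V where "V n = F n (u n) (u (n - 1))" for n
  define Y where "Y n = Yf (u n) (u (n - 1))" for n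
  define r where "r n = (u n)\<^sup>2 + (Y n)\<^sup>2" for n
  define w where "w n = V n / s" for n
  define l where "l n = ln (r n) + ln (real n) + 2 * ln (ln (real n))" for n
  have rec: "u (n + 1) = (E - V n) * u n - u (n - 1)" if "n \<ge> 1" for n
    using u(3)[OF that] by (simp add: V_def)
  have Yu: "s * Y n = u n * co - u (n - 1)" for n using s by (simp add: Y_def Yf_def)
  have recX: "u (Suc n) = s * (Y n - w n * u n) + co * u n" if "n \<ge> 1" for n
    using rec[OF that] Yu[of n] s by (simp add: w_def E_def algebra_simps)
  have recY: "Y (Suc n) = co * (Y n - w n * u n) - s * u n" if "n \<ge> 1" for n
  proof -
    have "s * Y (Suc n) = u (Suc n) * co - u n" using Yu[of "Suc n"] by simp
    also have "\<dots> = s * co * (Y n - w n * u n) - (1 - co\<^sup>2) * u n"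
      by (simp add: recX[OF that] algebra_simps power2_eq_square)
    also have "\<dots> = s * (co * (Y n - w n * u n) - s * u n)"
    proof -
      have "1 - co\<^sup>2 = s\<^sup>2" using sc by simp
      then show ?thesis by (simp only:) (simp add: algebra_simps power2_eq_square)
    qed
    finally show ?thesis using s by simp
  qed
  have w: "w n = c * (1 + unit_clamp (l n)) / real n * (if u n * Y n \<ge> 0 then 1 else -1)" for n
    using s by (simp add: w_def V_def F_def l_def r_def lf_def Y_def)
  have absw: "\<bar>w n\<bar> = c * (1 + unit_clamp (l n)) / real n" for n
    using c unit_clamp_bounds[of "l n"] by (simp add: w abs_mult)
  have absw_le: "\<bar>w n\<bar> \<le> 2 * c / real n" for n
    using c unit_clamp_bounds[of "l n"] by (simp add: absw divide_right_mono)
  have r_step: "r (Suc n) = (u n)\<^sup>2 + (Y n - w n * u n)\<^sup>2" if "n \<ge> 1" for n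
  proof -
    have "r (Suc n) = (s\<^sup>2 + co\<^sup>2) * ((u n)\<^sup>2 + (Y n - w n * u n)\<^sup>2)"
      unfolding r_def recX[OF that] recY[OF that] by (simp add: algebra_simps power2_eq_square)
    then show ?thesis using sc by simp
  qed
  have r_pos: "r n > 0" if "n \<ge> 1" for n
    using that
  proof (induction n rule: dec_induct)
    case base
    have "u 1 \<noteq> 0 \<or> Y 1 \<noteq> 0"
    proof (rule ccontr)
      assume "\<not> ?thesis"
      then have "cos \<phi> = 0" "sin \<phi> = 0" using Yu[of 1] u by auto
      then show False using sin_zero_abs_cos_one by fastforce
    qed
    then show ?case by (auto simp: r_def sum_power2_gt_zero_iff)
  next
    case (step n)
    then have "u n \<noteq> 0 \<or> Y n \<noteq> 0" by (auto simp: r_def)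
    then have "u n \<noteq> 0 \<or> Y n - w n * u n \<noteq> 0" by auto
    then show ?case using step by (auto simp: r_step sum_power2_gt_zero_iff)
  qed
  \<comment> \<open>With \<theta> the argument of \<open>Y + i u\<close>, \<open>g\<close> is the
    absolute value of \<open>sin (2 * \<theta>)\<close> and \<open>q\<close> below is the square of
    \<open>sin \<theta>\<close>.\<close>
  define g where "g n = 2 * \<bar>u n * Y n\<bar> / r n" for n
  have g: "0 \<le> g n" "g n \<le> 1" for n
  proof -
    have "2 * \<bar>u n * Y n\<bar> \<le> r n"
      using sum_squares_bound[of "\<bar>u n\<bar>" "\<bar>Y n\<bar>"] by (simp add: r_def abs_mult)
    then show "0 \<le> g n" "g n \<le> 1"
      by (auto simp: g_def divide_le_eq_1 r_def not_less sum_power2_le_zero_iff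
          intro!: divide_nonneg_nonneg)
  qed
  define q where "q n = (u n)\<^sup>2 / r n" for n
  have q: "0 \<le> q n" "q n \<le> 1" for n
    by (auto simp: q_def r_def divide_le_eq_1 not_less sum_power2_le_zero_iff add_nonneg_pos add_pos_nonneg)
  define x where "x n = (w n)\<^sup>2 * q n - \<bar>w n\<bar> * g n" for n
  have r_ratio: "r (Suc n) = r n * (1 + x n)" if "n \<ge> 1" for n
  proof -
    have "w n * (u n * Y n) = \<bar>w n\<bar> * \<bar>u n * Y n\<bar>"
      using c unit_clamp_bounds[of "l n"] unfolding absw by (simp add: w)
    moreover have "r n * g n = 2 * \<bar>u n * Y n\<bar>" "r n * q n = (u n)\<^sup>2"
      using r_pos[OF that] by (auto simp: g_def q_def)
    moreover have "r n * (1 + x n) = r n + (w n)\<^sup>2 * (r n * q n) - \<bar>w n\<bar> * (r n * g n)"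
      by (simp add: x_def algebra_simps)
    ultimately have "r n * (1 + x n) = r n + (w n)\<^sup>2 * (u n)\<^sup>2 - 2 * (w n * (u n * Y n))"
      by simp
    moreover have "r (Suc n) = r n + (w n)\<^sup>2 * (u n)\<^sup>2 - 2 * (w n * (u n * Y n))"
      unfolding r_step[OF that] r_def[of n] by (simp add: power2_eq_square algebra_simps)
    ultimately show ?thesis by simp
  qed

  \<comment> \<open>Increments of the logarithmic excess over the target\<close>
  define \<tau> where "\<tau> n = ln (real (Suc n)) - ln (real n) + 2 * (ln (ln (real (Suc n))) - ln (ln (real n)))" for n
  have x1: "1 + x n > 0" if "n \<ge> 1" for n
    using r_ratio[OF that] r_pos[OF that] r_pos[of "Suc n"] by (simp add: zero_less_mult_iff)
  have l_step: "l (Suc n) = l n + ln (1 + x n) + \<tau> n" if "n \<ge> 1" for n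
  proof -
    have "ln (r (Suc n)) = ln (r n) + ln (1 + x n)"
      unfolding r_ratio[OF that] using r_pos[OF that] x1[OF that] by (rule ln_mult_pos)
    then show ?thesis by (simp add: l_def \<tau>_def)
  qed
  have w0: "w \<longlonglongrightarrow> 0"
  proof (rule Lim_null_comparison)
    show "\<forall>\<^sub>F n in sequentially. norm (w n) \<le> 2 * c / real n" using absw_le by simp
    show "(\<lambda>n. 2 * c / real n) \<longlonglongrightarrow> 0" by real_asymp
  qed
  have x0: "x \<longlonglongrightarrow> 0"
  proof (rule Lim_null_comparison)
    show "\<forall>\<^sub>F n in sequentially. norm (x n) \<le> (w n)\<^sup>2 + \<bar>w n\<bar>"
    proof (intro always_eventually allI)
      fix n
      have "norm (x n) \<le> \<bar>(w n)\<^sup>2 * q n\<bar> + \<bar>\<bar>w n\<bar> * g n\<bar>"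
        unfolding x_def real_norm_def by (rule abs_triangle_ineq4)
      also have "\<dots> \<le> (w n)\<^sup>2 + \<bar>w n\<bar>"
        using q[of n] g[of n] by (intro add_mono) (auto simp: abs_mult intro: mult_left_le)
      finally show "norm (x n) \<le> (w n)\<^sup>2 + \<bar>w n\<bar>" .
    qed
    show "(\<lambda>n. (w n)\<^sup>2 + \<bar>w n\<bar>) \<longlonglongrightarrow> 0"
      using tendsto_add[OF tendsto_power[OF w0, of 2] tendsto_rabs[OF w0]] by simp
  qed
  have \<tau>0: "\<tau> \<longlonglongrightarrow> 0" unfolding \<tau>_def by real_asymp
  have l_diff: "(\<lambda>n. l (Suc n) - l n) \<longlonglongrightarrow> 0"
  proof -
    have "(\<lambda>n. ln (1 + x n) + \<tau> n) \<longlonglongrightarrow> ln (1 + 0) + 0"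
      by (intro tendsto_intros x0 \<tau>0) simp
    moreover have "\<forall>\<^sub>F n in sequentially. ln (1 + x n) + \<tau> n = l (Suc n) - l n"
      using eventually_ge_at_top[of 1] by eventually_elim (simp add: l_step)
    ultimately show ?thesis by (simp add: filterlim_cong[OF refl refl])
  qed
  \<comment> \<open>The product \<open>n * \<tau> n\<close> tends to 1, which is the constant 1 in
    the drift of \<open>feedback_limsup_nonpos\<close>; the term \<open>4 * c^2 / n\<close> absorbs
    the quadratic part of \<open>x\<close>.\<close>
  define e where "e n = real n * \<tau> n - 1 + 4 * c\<^sup>2 / real n" for n
  have e0: "e \<longlonglongrightarrow> 0" unfolding e_def \<tau>_def by real_asymp
  have step: "\<forall>\<^sub>F n in sequentially. l (Suc n) \<le> l n + (1 - c * (1 + unit_clamp (l n)) * g n + e n) / real n"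
    using eventually_ge_at_top[of 1]
  proof eventually_elim
    case (elim n)
    have "ln (1 + x n) \<le> x n" using x1[OF elim] by (intro ln_add_one_self_le_self2) linarith
    also have "x n \<le> (2 * c / real n)\<^sup>2 - \<bar>w n\<bar> * g n"
    proof -
      have "(w n)\<^sup>2 * q n \<le> (w n)\<^sup>2" using q[of n] by (intro mult_left_le) auto
      also have "\<dots> \<le> (2 * c / real n)\<^sup>2" using absw_le[of n] by (metis power2_abs power_mono abs_ge_zero)
      finally show ?thesis by (simp add: x_def)
    qed
    finally have "l (Suc n) \<le> l n + ((2 * c / real n)\<^sup>2 - \<bar>w n\<bar> * g n) + \<tau> n"
      using l_step[OF elim] by simp
    also have "\<dots> = l n + (1 - c * (1 + unit_clamp (l n)) * g n + e n) / real n"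
      using elim unfolding absw by (simp add: e_def field_simps power2_eq_square)
    finally show ?case .
  qed

  \<comment> \<open>Comparison of the phase with a free rotation\<close>
  define Z where "Z n = Complex (Y n) (u n)" for n
  have Z_norm: "(norm (Z n))\<^sup>2 = r n" for n by (simp add: Z_def r_def cmod_def)
  have Z_nz: "Z n \<noteq> 0" if "n \<ge> 1" for n using r_pos[OF that] Z_norm[of n] by auto
  have Z_step: "Z (Suc n) = cis (pi * k) * (Z n - of_real (w n * u n))" if "n \<ge> 1" for n
    by (simp add: Z_def complex_eq_iff recX[OF that] recY[OF that] s_def co_def)
  \<comment> \<open>The unit vector \<open>sgn (Z n)\<close> represents the phase without choosing a
    branch of the angle along the orbit.\<close>
  have sgn_step: "norm (sgn (Z (Suc n)) - cis (pi * k) * sgn (Z n)) \<le> 4 * c / real n" if "n \<ge> 1" for n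
  proof -
    have "cis (pi * k) * sgn (Z n) = sgn (cis (pi * k) * Z n)"
      by (simp add: Real_Vector_Spaces.sgn_mult)
    moreover have "norm (sgn (Z (Suc n)) - sgn (cis (pi * k) * Z n))
        \<le> 2 * norm (Z (Suc n) - cis (pi * k) * Z n) / norm (cis (pi * k) * Z n)"
      using Z_nz[OF that] Z_nz[of "Suc n"] by (intro norm_sgn_diff_le) auto
    moreover have "norm (Z (Suc n) - cis (pi * k) * Z n) = \<bar>w n\<bar> * \<bar>u n\<bar>"
      unfolding Z_step[OF that] by (simp add: right_diff_distrib norm_mult abs_mult)
    moreover have "\<bar>w n\<bar> * \<bar>u n\<bar> \<le> (2 * c / real n) * norm (Z n)"
      using absw_le[of n] abs_Im_le_cmod[of "Z n"] by (intro mult_mono) (auto simp: Z_def)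
    then have "2 * (\<bar>w n\<bar> * \<bar>u n\<bar>) / norm (Z n) \<le> 2 * ((2 * c / real n) * norm (Z n)) / norm (Z n)"
      by (intro divide_right_mono mult_left_mono) auto
    moreover have "2 * ((2 * c / real n) * norm (Z n)) / norm (Z n) = 4 * c / real n"
      using Z_nz[OF that] by simp
    moreover have "norm (cis (pi * k) * Z n) = norm (Z n)" by (simp add: norm_mult)
    ultimately show ?thesis by simp
  qed
  have sgn_steps: "norm (sgn (Z (n + j)) - cis (pi * k * real j) * sgn (Z n)) \<le> real j * (4 * c / real n)"
    if "n \<ge> 1" for n j
  proof (induction j)
    case (Suc j)
    have "sgn (Z (n + Suc j)) - cis (pi * k * real (Suc j)) * sgn (Z n)
        = (sgn (Z (Suc (n + j))) - cis (pi * k) * sgn (Z (n + j)))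
          + cis (pi * k) * (sgn (Z (n + j)) - cis (pi * k * real j) * sgn (Z n))"
      by (simp add: algebra_simps cis_mult)
    also have "norm \<dots> \<le> 4 * c / real (n + j) + real j * (4 * c / real n)"
      using sgn_step[of "n + j"] that Suc
      by (intro order.trans[OF norm_triangle_ineq] add_mono) (auto simp: norm_mult)
    also have "4 * c / real (n + j) \<le> 4 * c / real n"
      using c that by (intro divide_left_mono) auto
    also have "4 * c / real n + real j * (4 * c / real n) = real (Suc j) * (4 * c / real n)"
      by (simp only: of_nat_Suc distrib_right mult_1_left)
    finally show ?case by simp
  qed simp
  have g_Im: "g n = \<bar>Im ((sgn (Z n))\<^sup>2)\<bar>" if "n \<ge> 1" for n
  proof -
    have "Im ((sgn (Z n))\<^sup>2) = 2 * (u n * Y n) / r n"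
      by (simp add: power2_eq_square sgn_div_norm Z_norm[symmetric]) (simp add: Z_def field_simps)
    then show ?thesis using r_pos[OF that] by (simp add: g_def abs_mult)
  qed
  \<comment> \<open>Squaring the unit vectors doubles the angle; factoring the difference of squares
    costs a factor 2, which turns \<open>4 * c\<close> into \<open>8 * c\<close>.\<close>
  have g_ge: "g (n + j) \<ge> \<bar>sin (2 * Arg (Z n) + 2 * pi * k * real j)\<bar> - real j * (8 * c / real n)" if "n \<ge> 1" for n j
  proof -
    let ?a = "sgn (Z (n + j))" and ?b = "cis (pi * k * real j) * sgn (Z n)"
    have b: "?b = cis (Arg (Z n) + pi * k * real j)"
      using cis_Arg[OF Z_nz[OF that], symmetric] by (simp add: cis_mult add_ac)
    have "?a\<^sup>2 - ?b\<^sup>2 = (?a - ?b) * (?a + ?b)" by (simp add: power2_eq_square algebra_simps)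
    then have "norm (?a\<^sup>2 - ?b\<^sup>2) \<le> (real j * (4 * c / real n)) * 2"
      using sgn_steps[OF that, of j] c
      by (simp only: norm_mult) (intro mult_mono order.trans[OF norm_triangle_ineq]; simp add: norm_mult norm_sgn)
    then have "\<bar>Im (?a\<^sup>2) - Im (?b\<^sup>2)\<bar> \<le> real j * (8 * c / real n)"
      using abs_Im_le_cmod[of "?a\<^sup>2 - ?b\<^sup>2"] by (simp add: mult_ac)
    moreover have "Im (?b\<^sup>2) = sin (2 * Arg (Z n) + 2 * pi * k * real j)"
      unfolding b power2_eq_square cis_mult by (simp add: algebra_simps)
    moreover have "g (n + j) = \<bar>Im (?a\<^sup>2)\<bar>" using that by (intro g_Im) auto
    ultimately show ?thesis by linarith
  qed
  have g_avg: "\<exists>L>0. \<forall>\<^sub>F n in sequentially. (\<Sum>j<L. g (n + j)) \<ge> real L * (A - \<eta>)" if "\<eta> > 0" for \<eta>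
  proof -
    \<comment> \<open>Half of \<eta> is spent on the free average, half on the deviation of the
      phase from the free rotation.\<close>
    from avg[OF half_gt_zero[OF that]] obtain L
      where L: "L > 0" "\<And>x. (\<Sum>j<L. \<bar>sin (x + 2 * pi * k * real j)\<bar>) \<ge> real L * (A - \<eta> / 2)"
      by (elim exE conjE) (rule that, assumption, erule spec)
    have "(\<lambda>n. real L * (8 * c / real n)) \<longlonglongrightarrow> 0" by real_asymp
    then have "\<forall>\<^sub>F n in sequentially. real L * (8 * c / real n) < \<eta> / 2"
      using that by (intro order_tendstoD) auto
    then have "\<forall>\<^sub>F n in sequentially. (\<Sum>j<L. g (n + j)) \<ge> real L * (A - \<eta>)"
      using eventually_ge_at_top[of 1]
    proof eventually_elim
      case (elim n)
      have "real L * (A - \<eta>) \<le> (\<Sum>j<L. \<bar>sin (2 * Arg (Z n) + 2 * pi * k * real j)\<bar>) - real L * (\<eta> / 2)"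
        using L(2)[of "2 * Arg (Z n)"] by (simp add: algebra_simps)
      also have "\<dots> = (\<Sum>j<L. \<bar>sin (2 * Arg (Z n) + 2 * pi * k * real j)\<bar> - \<eta> / 2)"
        by (simp add: sum_subtractf)
      also have "\<dots> \<le> (\<Sum>j<L. g (n + j))"
      proof (rule sum_mono)
        fix j assume "j \<in> {..<L}"
        then have "real j * (8 * c / real n) \<le> real L * (8 * c / real n)"
          using c by (intro mult_right_mono) auto
        with g_ge[OF elim(2), of j] elim(1)
        show "\<bar>sin (2 * Arg (Z n) + 2 * pi * k * real j)\<bar> - \<eta> / 2 \<le> g (n + j)" by linarith
      qed
      finally show ?case .
    qed
    with L(1) show ?thesis by auto
  qed
  have l_le: "\<forall>\<^sub>F n in sequentially. l n \<le> \<eta>" if "\<eta> > 0" for \<eta>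
    by (rule feedback_limsup_nonpos[OF step l_diff g e0 c g_avg that])
  \<comment> \<open>The clamp sends all negative values to 0, so the upper bound on \<open>l\<close>
    suffices.\<close>
  have "(\<lambda>n. unit_clamp (l n)) \<longlonglongrightarrow> 0"
  proof (rule tendstoI)
    fix \<eta> :: real assume "\<eta> > 0"
    then have "\<forall>\<^sub>F n in sequentially. l n \<le> \<eta> / 2" by (intro l_le) simp
    then show "\<forall>\<^sub>F n in sequentially. dist (unit_clamp (l n)) 0 < \<eta>"
      by eventually_elim (use \<open>\<eta> > 0\<close> in \<open>auto simp: unit_clamp_def\<close>)
  qed
  then have "(\<lambda>n. s * (c * (1 + unit_clamp (l n)))) \<longlonglongrightarrow> s * (c * (1 + 0))"
    by (intro tendsto_intros)
  moreover have "\<forall>\<^sub>F n in sequentially. s * (c * (1 + unit_clamp (l n))) = \<bar>real n * V n\<bar>"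
    using eventually_ge_at_top[of 1]
  proof eventually_elim
    case (elim n)
    have "\<bar>real n * V n\<bar> = real n * (s * \<bar>w n\<bar>)" using s by (simp add: w_def abs_mult)
    then show ?case using elim by (simp add: absw)
  qed
  ultimately have lim: "(\<lambda>n. \<bar>real n * V n\<bar>) \<longlonglongrightarrow> sin (pi * k) / A"
    by (simp add: filterlim_cong[OF refl refl] s_def c_def)
  have "summable (\<lambda>n. \<bar>u n\<bar>\<^sup>2)"
  proof (rule summable_comparison_test_ev)
    show "summable (\<lambda>n. exp 1 * (1 / (real n * (ln (real n))\<^sup>2)))"
      by (intro summable_mult summable_inverse_n_ln_squared)
    show "\<forall>\<^sub>F n in sequentially. norm (\<bar>u n\<bar>\<^sup>2) \<le> exp 1 * (1 / (real n * (ln (real n))\<^sup>2))"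
      using l_le[of 1, simplified] eventually_ge_at_top[of 2]
    proof eventually_elim
      case (elim n)
      have pos: "r n > 0" "ln (real n) > 0" "real n > 0" using r_pos[of n] elim(2) by auto
      have "ln (r n * (real n * (ln (real n))\<^sup>2)) = l n"
        using pos by (simp add: l_def ln_mult ln_realpow)
      then have "r n * (real n * (ln (real n))\<^sup>2) \<le> exp 1"
        using elim(1) pos by (metis exp_le_cancel_iff exp_ln mult_pos_pos zero_less_power)
      then have "r n \<le> exp 1 * (1 / (real n * (ln (real n))\<^sup>2))"
        using pos by (simp add: pos_le_divide_eq)
      then show ?case by (simp add: r_def) (smt (verit) zero_le_power2)
    qed
  qed
  moreover have "\<exists>n. u n \<noteq> 0"
    using u sin_zero_abs_cos_one by (metis abs_zero zero_neq_one)
  moreover have "boundary_condition \<phi> u" using u(1,2) by (simp add: boundary_condition_def)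
  ultimately have "is_eigenvalue V \<phi> E"
    unfolding is_eigenvalue_def using rec by (auto simp: schroedinger_def algebra_simps intro!: exI[of _ u])
  with lim show ?thesis by (auto simp: E_def co_def)
qed

section \<open>Prescribed solutions for even denominators\<close>

text \<open>Where a sequence does not vanish, the equation can be solved for the potential. The
  first sites are overwritten to meet the boundary condition; this changes finitely many values of
  the potential and leaves limit and summability intact.\<close>

lemma eigenvalue_of_nonvanishing_tail:
  fixes u :: "nat \<Rightarrow> real"
  assumes nz: "\<forall>\<^sub>F n in sequentially. u n \<noteq> 0"
    and sum: "summable (\<lambda>n. (u n)\<^sup>2)"
    and lim: "(\<lambda>n. \<bar>real n * (E - (u (n + 1) + u (n - 1)) / u n)\<bar>) \<longlonglongrightarrow> C"
  shows "\<exists>V. (\<lambda>n. \<bar>real n * V n\<bar>) \<longlonglongrightarrow> C \<and> is_eigenvalue V \<phi> E"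
proof -
  obtain N where N: "N \<ge> 3" "\<And>n. n \<ge> N \<Longrightarrow> u n \<noteq> 0"
    using eventually_conj[OF nz eventually_ge_at_top[of 3]]
    by (auto simp: eventually_sequentially)
  \<comment> \<open>If \<open>sin \<phi> = 0\<close> then \<open>v 1 = 0\<close>, and the equation at 1 forces \<open>v 2 = - v 0\<close>.\<close>
  define v where "v n = (if n \<ge> N then u n else if n = 0 then cos \<phi> else if n = 1 then sin \<phi>
      else if n = 2 \<and> sin \<phi> = 0 then - cos \<phi> else 1)" for n
  have v012: "v 0 = cos \<phi>" "v 1 = sin \<phi>" "v 2 = (if sin \<phi> = 0 then - cos \<phi> else 1)"
    using N(1) by (auto simp: v_def)
  have sc: "sin \<phi> = 0 \<Longrightarrow> cos \<phi> \<noteq> 0" using sin_zero_abs_cos_one by fastforce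
  have v_nz: "v n \<noteq> 0" if "n \<ge> 2" for n
    using that N(2)[of n] sc by (auto simp: v_def)
  define V where "V n = E - (v (n + 1) + v (n - 1)) / v n" for n
  have eq: "schroedinger V v n = E * v n" if "n \<ge> 1" for n
  proof (cases "v n = 0")
    case True
    with v_nz[of n] that have n: "n = 1" by (cases "n = 1") auto
    then have "v (n + 1) + v (n - 1) = 0"
      using True v012 by (simp add: numeral_2_eq_2)
    then show ?thesis using True by (simp add: schroedinger_def)
  qed (simp add: schroedinger_def V_def field_simps)
  have tail: "\<forall>\<^sub>F n in sequentially. v n = u n"
    using eventually_ge_at_top[of N] by eventually_elim (simp add: v_def)
  have "summable (\<lambda>n. \<bar>v n\<bar>\<^sup>2)"
    using sum tail by (subst summable_cong[of _ "\<lambda>n. (u n)\<^sup>2"]) (auto elim: eventually_mono)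
  moreover have "\<exists>n. v n \<noteq> 0" using v_nz[of 2] by auto
  moreover have "boundary_condition \<phi> v"
    using v012(1,2) by (simp add: boundary_condition_def)
  ultimately have "is_eigenvalue V \<phi> E"
    unfolding is_eigenvalue_def using eq by blast
  moreover have "\<forall>\<^sub>F n in sequentially.
      \<bar>real n * (E - (u (n + 1) + u (n - 1)) / u n)\<bar> = \<bar>real n * V n\<bar>"
    using eventually_ge_at_top[of "N + 1"]
  proof eventually_elim
    case (elim n)
    then have "v (n + 1) = u (n + 1)" "v n = u n" "v (n - 1) = u (n - 1)" by (auto simp: v_def)
    then show ?case by (simp add: V_def)
  qed
  then have "(\<lambda>n. \<bar>real n * V n\<bar>) \<longlonglongrightarrow> C" using lim by (rule Lim_transform_eventually[rotated])
  ultimately show ?thesis by blast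
qed

lemma sum_lessThan_add: "(\<Sum>j<m + n. f j) = (\<Sum>j<m. f j) + (\<Sum>j<n. f (m + j :: nat))"
  for f :: "nat \<Rightarrow> 'a :: comm_monoid_add"
  by (induction n) (simp_all add: add_ac)

lemma periodic_mod_nat:
  fixes f :: "nat \<Rightarrow> 'a"
  assumes "\<And>n. f (n + q) = f n"
  shows "f (n mod q) = f n"
proof -
  have "f (r + i * q) = f r" for r i
  proof (induction i)
    case (Suc i)
    then show ?case using assms[of "r + i * q"] by (simp add: add_ac)
  qed simp
  from this[of "n mod q" "n div q"] show ?thesis by simp
qed

lemma bounded_periodic:
  fixes f :: "nat \<Rightarrow> real"
  assumes "\<And>n. f (n + q) = f n" "q > 0"
  shows "\<bar>f n\<bar> \<le> (\<Sum>r<q. \<bar>f r\<bar>)"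
proof -
  have "\<bar>f (n mod q)\<bar> \<le> (\<Sum>r<q. \<bar>f r\<bar>)"
    using assms(2) by (intro member_le_sum) auto
  then show ?thesis using periodic_mod_nat[of f q n] assms(1) by simp
qed

text \<open>Zero mean makes the partial sums themselves periodic.\<close>

lemma bounded_partial_sums_periodic:
  fixes f :: "nat \<Rightarrow> real"
  assumes "\<And>n. f (n + q) = f n" "(\<Sum>j<q. f j) = 0" "q > 0"
  shows "\<exists>B. \<forall>n. \<bar>\<Sum>j<n. f j\<bar> \<le> B"
proof -
  have "(\<Sum>j<n + q. f j) = (\<Sum>j<n. f j)" for n
    using sum_lessThan_add[of f q n] assms(1,2) by (simp add: add.commute)
  from bounded_periodic[where f = "\<lambda>n. \<Sum>j<n. f j", OF this \<open>q > 0\<close>] show ?thesis by blast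
qed

text \<open>The second half of the grid is the first shifted by \<open>pi\<close>: the absolute sine
  repeats and the cosine changes sign. In the first half the offset makes the numerator in
  \<open>sum_sin_arith_pi\<close> equal to \<open>cos 0\<close>, its maximum, so the mean of the
  absolute sine is \<open>A_const (2 * m)\<close>.\<close>

lemma sum_abs_sin_odd_multiples:
  assumes "m > 0"
  shows "(\<Sum>j<2 * m. \<bar>sin (pi * (2 * real j + 1) / real (2 * m))\<bar>) = 2 / sin (pi / real (2 * m))"
    and "(\<Sum>j<2 * m. cos (pi * (2 * real j + 1) / real (2 * m))) = 0"
proof -
  define x where "x j = pi * (2 * real j + 1) / real (2 * m)" for j
  have shift: "x (m + j) = x j + pi" for j using assms by (simp add: x_def field_simps)
  have "(\<Sum>j<m. \<bar>sin (x j)\<bar>) = (\<Sum>j<m. sin (pi / (2 * real m) + pi * real j / real m))"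
  proof (intro sum.cong refl)
    fix j assume "j \<in> {..<m}"
    then have j: "real j + 1 \<le> real m" by auto
    have "pi * (2 * real j + 1) \<le> pi * real (2 * m)" using j by (intro mult_left_mono) auto
    then have "x j \<le> pi" "x j \<ge> 0"
      using assms by (auto simp: x_def pos_divide_le_eq)
    then have "sin (x j) \<ge> 0" by (rule sin_ge_zero[rotated])
    moreover have "x j = pi / (2 * real m) + pi * real j / real m" using assms by (simp add: x_def field_simps)
    ultimately show "\<bar>sin (x j)\<bar> = sin (pi / (2 * real m) + pi * real j / real m)" by simp
  qed
  also have "\<dots> = 1 / sin (pi / (2 * real m))"
    using sum_sin_arith_pi[OF assms, of "pi / (2 * real m)"] by simp
  finally have half: "(\<Sum>j<m. \<bar>sin (x j)\<bar>) = 1 / sin (pi / (2 * real m))" .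
  have split: "(\<Sum>j<2 * m. h (x j)) = (\<Sum>j<m. h (x j)) + (\<Sum>j<m. h (x j + pi))" for h :: "real \<Rightarrow> real"
    using sum_lessThan_add[of "\<lambda>j. h (x j)" m m] by (simp add: mult_2[symmetric] shift)
  show "(\<Sum>j<2 * m. \<bar>sin (pi * (2 * real j + 1) / real (2 * m))\<bar>) = 2 / sin (pi / real (2 * m))"
    using split[of "\<lambda>y. \<bar>sin y\<bar>"] half unfolding x_def by simp
  show "(\<Sum>j<2 * m. cos (pi * (2 * real j + 1) / real (2 * m))) = 0"
    using split[of cos] unfolding x_def by (simp add: sum_negf)
qed

text \<open>The reflection of \<open>x\<close> to \<open>2 * pi - x\<close> maps the grid to itself,
  reversing its order, so the sum equals its own negative.\<close>

lemma sum_odd_function_odd_multiples: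
  fixes \<Psi> :: "real \<Rightarrow> real"
  assumes "\<And>x. \<Psi> (2 * pi - x) = - \<Psi> x" "q > 0"
  shows "(\<Sum>j<q. \<Psi> (pi * (2 * real j + 1) / real q)) = 0"
proof -
  have "(\<Sum>j<q. \<Psi> (pi * (2 * real j + 1) / real q)) = (\<Sum>j<q. \<Psi> (pi * (2 * real (q - Suc j) + 1) / real q))"
    by (rule sum.nat_diff_reindex[symmetric])
  also have "\<dots> = (\<Sum>j<q. - \<Psi> (pi * (2 * real j + 1) / real q))"
  proof (intro sum.cong refl)
    fix j assume "j \<in> {..<q}"
    then have "pi * (2 * real (q - Suc j) + 1) / real q = 2 * pi - pi * (2 * real j + 1) / real q"
      by (simp add: of_nat_diff field_simps)
    then show "\<Psi> (pi * (2 * real (q - Suc j) + 1) / real q) = - \<Psi> (pi * (2 * real j + 1) / real q)"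
      by (simp only: assms(1))
  qed
  also have "\<dots> = - (\<Sum>j<q. \<Psi> (pi * (2 * real j + 1) / real q))" by (rule sum_negf)
  finally show ?thesis by simp
qed

text \<open>The logarithmic derivative of the envelope \<open>T\<close>, times \<open>x\<close>, is
  \<open>- 1 / 2 - 1 / ln x\<close>; only the square root contributes in the limit.\<close>

lemma scaled_ratio_tendsto:
  defines "T \<equiv> \<lambda>x :: real. 1 / (sqrt x * ln x)"
  shows "(\<lambda>n. real n * (1 - T (real n + 1) / T (real n))) \<longlonglongrightarrow> 1 / 2"
    and "(\<lambda>n. real n * (1 - T (real n - 1) / T (real n))) \<longlonglongrightarrow> - 1 / 2"
proof -
  define r where "r d n = sqrt (real n) / sqrt (real n + d)" for d :: real and n :: nat
  have ratio: "\<forall>\<^sub>F n in sequentially. real n * (1 - r d n) + r d n * (real n * (ln (real n + d) - ln (real n)) / ln (real n + d))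
      = real n * (1 - T (real n + d) / T (real n))" if "\<bar>d\<bar> \<le> 1" for d
    using eventually_ge_at_top[of 3]
  proof eventually_elim
    case (elim n)
    then have pos: "ln (real n + d) > 0" "ln (real n) > 0" using that by (auto simp: abs_le_iff)
    have "T (real n + d) / T (real n) = r d n * (ln (real n) / ln (real n + d))"
      by (simp add: T_def r_def)
    moreover have "real n * (ln (real n + d) - ln (real n)) / ln (real n + d) = real n * (1 - ln (real n) / ln (real n + d))"
      using pos by (simp add: field_simps)
    ultimately show ?case by (simp only:) (simp add: right_diff_distrib mult_ac)
  qed
  have "(\<lambda>n. real n * (1 - r 1 n) + r 1 n * (real n * (ln (real n + 1) - ln (real n)) / ln (real n + 1))) \<longlonglongrightarrow> 1 / 2 + 1 * 0"
    unfolding r_def by (intro tendsto_add tendsto_mult; real_asymp)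
  with ratio[of 1] show "(\<lambda>n. real n * (1 - T (real n + 1) / T (real n))) \<longlonglongrightarrow> 1 / 2"
    by (auto intro: Lim_transform_eventually)
  have "(\<lambda>n. real n * (1 - r (-1) n) + r (-1) n * (real n * (ln (real n + -1) - ln (real n)) / ln (real n + -1))) \<longlonglongrightarrow> - 1 / 2 + 1 * 0"
    unfolding r_def by (intro tendsto_add tendsto_mult; real_asymp)
  with ratio[of "-1"] show "(\<lambda>n. real n * (1 - T (real n - 1) / T (real n))) \<longlonglongrightarrow> - 1 / 2"
    by (auto intro: Lim_transform_eventually)
qed

text \<open>Insert \<open>(sin \<theta> + \<kappa> / n) * T\<close> into the equation. At order
  \<open>1 / n\<close> the envelope contributes \<open>s * cos \<theta>\<close>, and a potential
  close to \<open>C * \<sigma> / n\<close> results if \<kappa> solves the free equation with forcing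
  \<open>f\<close>. The value of \<open>C\<close> removes the resonance, so \<kappa> stays
  bounded.\<close>

lemma even_eigenvalue:
  fixes p q :: nat and \<phi> :: real
  assumes q: "even q" "q > 0" and p: "coprime p q" "0 < p" "p < q"
  defines "k \<equiv> real p / real q"
  shows "\<exists>V. (\<lambda>n. \<bar>real n * V n\<bar>) \<longlonglongrightarrow> sin (pi * k) * (real q * sin (pi / real q)) / 2
           \<and> is_eigenvalue V \<phi> (2 * cos (pi * k))"
proof -
  define s where "s = sin (pi * k)"
  define E where "E = 2 * cos (pi * k)"
  define C where "C = s * (real q * sin (pi / real q)) / 2"
  have q2: "q \<ge> 2" using q by (cases "q = 1") auto
  have "0 < k" "k < 1" using p by (auto simp: k_def)
  then have s: "s > 0" unfolding s_def by (intro sin_gt_zero) auto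
  have sq: "sin (pi / real q) > 0" using q2 by (intro sin_gt_zero) (auto simp: field_simps)
  have C: "C > 0" using s sq q by (simp add: C_def)
  obtain m where m: "q = 2 * m" "m > 0" using q by (auto elim!: evenE)
  \<comment> \<open>The initial phase makes \<open>2 * \<theta> n\<close> run through the odd
    multiples of \<open>pi / q\<close> modulo \<open>2 * pi\<close>, where the mean of the absolute
    sine is \<open>A_const q\<close>.\<close>
  define \<theta> where "\<theta> n = pi / (2 * real q) + pi * k * real n" for n :: nat
  define \<sigma> where "\<sigma> n = sgn (sin (2 * \<theta> n))" for n
  define f where "f n = s * cos (\<theta> n) - C * \<sigma> n * sin (\<theta> n)" for n
  define P where "P n = f n * cos (\<theta> n)" for n
  define Q where "Q n = f n * sin (\<theta> n)" for n
  \<comment> \<open>Expressing \<open>P\<close> and \<open>Q\<close> through the doubled angle gives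
    functions of period \<open>2 * pi\<close>, to which the grid sums apply; \<open>\<Phi>Q\<close>
    is odd under reflection at \<open>pi\<close>.\<close>
  define \<Phi>P where "\<Phi>P x = s * (1 + cos x) / 2 - C / 2 * \<bar>sin x\<bar>" for x
  define \<Phi>Q where "\<Phi>Q x = s / 2 * sin x - C / 2 * (sgn (sin x) * (1 - cos x))" for x
  have P: "P n = \<Phi>P (2 * \<theta> n)" for n
  proof -
    have "P n = s * (cos (\<theta> n))\<^sup>2 - C / 2 * (\<sigma> n * sin (2 * \<theta> n))"
      unfolding P_def f_def sin_double by (simp add: power2_eq_square algebra_simps)
    moreover have "(cos (\<theta> n))\<^sup>2 = (1 + cos (2 * \<theta> n)) / 2" by (simp add: cos_double_cos)
    ultimately show ?thesis by (simp add: \<Phi>P_def \<sigma>_def sgn_mult_self_eq abs_sgn_eq sgn_if)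
  qed
  have Q: "Q n = \<Phi>Q (2 * \<theta> n)" for n
  proof -
    have "Q n = s / 2 * sin (2 * \<theta> n) - C * \<sigma> n * (sin (\<theta> n))\<^sup>2"
      unfolding Q_def f_def sin_double by (simp add: power2_eq_square algebra_simps)
    moreover have "(sin (\<theta> n))\<^sup>2 = (1 - cos (2 * \<theta> n)) / 2" by (simp add: cos_double_sin)
    ultimately show ?thesis by (simp add: \<Phi>Q_def \<sigma>_def)
  qed
  have per\<theta>: "2 * \<theta> (n + q) = 2 * \<theta> n + 2 * pi * of_int (int p)" for n
    using q by (simp add: \<theta>_def k_def field_simps)
  have trig_per: "sin (x + 2 * pi * of_int i) = sin x" "cos (x + 2 * pi * of_int i) = cos x" for x :: real and i :: int
    by (simp_all add: sin_add cos_add)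
  have \<Phi>_per: "\<Phi>P (x + 2 * pi * of_int i) = \<Phi>P x" "\<Phi>Q (x + 2 * pi * of_int i) = \<Phi>Q x" for x i
    by (simp_all only: \<Phi>P_def \<Phi>Q_def trig_per)
  have sum_\<Phi>: "(\<Sum>j<q. \<Psi> (2 * \<theta> j)) = (\<Sum>j<q. \<Psi> (pi * (2 * real j + 1) / real q))"
    if "\<And>x i. \<Psi> (x + 2 * pi * of_int i) = \<Psi> x" for \<Psi> :: "real \<Rightarrow> real"
  proof -
    define h where "h t = \<Psi> (pi / real q + 2 * pi * of_int t / real q)" for t :: int
    have "h (t + int q) = h t" for t
    proof -
      have "pi / real q + 2 * pi * of_int (t + int q) / real q
          = (pi / real q + 2 * pi * of_int t / real q) + 2 * pi * of_int 1"
        using q by (simp add: field_simps)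
      then show ?thesis unfolding h_def by (simp only: that)
    qed
    then have "(\<Sum>j<q. h (0 + int p * int j)) = (\<Sum>j<q. h (int j))"
      using p q by (intro sum_periodic_coprime) auto
    moreover have "h (0 + int p * int j) = \<Psi> (2 * \<theta> j)" for j
    proof -
      have "pi / real q + 2 * pi * of_int (0 + int p * int j) / real q = 2 * \<theta> j"
        using q by (simp add: \<theta>_def k_def field_simps)
      then show ?thesis unfolding h_def by (rule arg_cong)
    qed
    moreover have "h (int j) = \<Psi> (pi * (2 * real j + 1) / real q)" for j
    proof -
      have "pi / real q + 2 * pi * of_int (int j) / real q = pi * (2 * real j + 1) / real q"
        by (simp add: distrib_left add_divide_distrib)
      then show ?thesis unfolding h_def by (rule arg_cong)
    qed
    ultimately show ?thesis by simp
  qed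
  \<comment> \<open>The forcing \<open>f\<close> is orthogonal over a period to both solutions of the free equation: to the
    cosine by the choice of \<open>C\<close>, to the sine by the symmetry of the phases.\<close>
  have "(\<Sum>j<q. P j) = (\<Sum>j<q. \<Phi>P (pi * (2 * real j + 1) / real q))"
    unfolding P by (intro sum_\<Phi> \<Phi>_per)
  also have "\<dots> = s / 2 * (real q + (\<Sum>j<q. cos (pi * (2 * real j + 1) / real q)))
      - C / 2 * (\<Sum>j<q. \<bar>sin (pi * (2 * real j + 1) / real q)\<bar>)"
    by (simp add: \<Phi>P_def sum_subtractf sum.distrib sum_distrib_left add_divide_distrib distrib_left sum_divide_distrib)
  also have "\<dots> = 0"
    using sum_abs_sin_odd_multiples[OF m(2)] sq by (simp add: m(1)[symmetric] C_def)
  finally have sumP: "(\<Sum>j<q. P j) = 0" .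
  have "(\<Sum>j<q. Q j) = (\<Sum>j<q. \<Phi>Q (pi * (2 * real j + 1) / real q))"
    unfolding Q by (intro sum_\<Phi> \<Phi>_per)
  also have "\<dots> = 0"
    using q(2) by (intro sum_odd_function_odd_multiples)
      (simp_all add: \<Phi>Q_def sin_diff cos_diff sgn_minus algebra_simps)
  finally have sumQ: "(\<Sum>j<q. Q j) = 0" .
  have perPQ: "P (n + q) = P n" "Q (n + q) = Q n" for n
    unfolding P Q per\<theta> by (rule \<Phi>_per)+
  define SP where "SP n = (\<Sum>j<n. P j)" for n
  define SQ where "SQ n = (\<Sum>j<n. Q j)" for n
  obtain B1 where B1: "\<And>n. \<bar>SP n\<bar> \<le> B1"
    using bounded_partial_sums_periodic[of P, OF perPQ(1) sumP q(2)] by (auto simp: SP_def)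
  obtain B2 where B2: "\<And>n. \<bar>SQ n\<bar> \<le> B2"
    using bounded_partial_sums_periodic[of Q, OF perPQ(2) sumQ q(2)] by (auto simp: SQ_def)
  \<comment> \<open>Variation of constants.\<close>
  define \<kappa> where "\<kappa> n = (sin (\<theta> n) * SP n - cos (\<theta> n) * SQ n) / s" for n
  define K where "K = (B1 + B2) / s"
  have \<kappa>: "\<bar>\<kappa> n\<bar> \<le> K" for n
  proof -
    have "\<bar>sin (\<theta> n) * SP n - cos (\<theta> n) * SQ n\<bar> \<le> \<bar>sin (\<theta> n)\<bar> * \<bar>SP n\<bar> + \<bar>cos (\<theta> n)\<bar> * \<bar>SQ n\<bar>"
      by (rule order.trans[OF abs_triangle_ineq4]) (simp add: abs_mult)
    also have "\<dots> \<le> 1 * B1 + 1 * B2"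
      using B1[of n] B2[of n] by (intro add_mono mult_mono) auto
    finally show ?thesis using s by (simp add: \<kappa>_def K_def abs_divide divide_right_mono)
  qed
  have K: "K \<ge> 0" using \<kappa>[of 0] by linarith
  have \<theta>_Suc: "\<theta> (Suc n) = \<theta> n + pi * k" for n by (simp add: \<theta>_def algebra_simps)
  have \<kappa>_rec: "\<kappa> (n + 1) + \<kappa> (n - 1) - E * \<kappa> n = f n" if n1: "n \<ge> 1" for n
  proof -
    obtain i where n: "n = Suc i" using n1 by (cases n) auto
    define x y where "x = \<theta> n" and "y = pi * k"
    have \<theta>: "\<theta> n = x" "\<theta> (Suc n) = x + y" "\<theta> i = x - y" by (simp_all add: x_def y_def \<theta>_Suc n)
    have E: "E = 2 * cos y" and s': "s = sin y" by (simp_all add: E_def s_def y_def)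
    have S: "SP (Suc n) = SP i + P i + P n" "SP n = SP i + P i"
       "SQ (Suc n) = SQ i + Q i + Q n" "SQ n = SQ i + Q i" by (simp_all add: SP_def SQ_def n)
    have PQ: "P n = f n * cos x" "Q n = f n * sin x" "P i = f i * cos (x - y)" "Q i = f i * sin (x - y)"
      by (simp_all add: P_def Q_def \<theta>)
    \<comment> \<open>Sine and cosine solve the free equation (\<open>e1\<close>) and have Wronskian
      \<open>s\<close> (\<open>e2\<close>). In the regrouped expression the leftover terms at
      \<open>i\<close> cancel each other, and those at \<open>n\<close> give \<open>f n\<close>
      times the Wronskian.\<close>
    have e1: "sin (x + y) + sin (x - y) - 2 * cos y * sin x = 0" "cos (x + y) + cos (x - y) - 2 * cos y * cos x = 0"
      by (simp_all add: sin_add sin_diff cos_add cos_diff)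
    have e2: "sin (x + y) * cos x - cos (x + y) * sin x = sin y"
      using sin_diff[of "x + y" x] by simp
    have s\<kappa>: "s * \<kappa> j = sin (\<theta> j) * SP j - cos (\<theta> j) * SQ j" for j
      using s by (simp add: \<kappa>_def)
    have "s * (\<kappa> (n + 1) + \<kappa> (n - 1) - E * \<kappa> n) = s * \<kappa> (Suc n) + s * \<kappa> i - E * (s * \<kappa> n)"
      by (simp add: n algebra_simps)
    also have "\<dots> = (sin (x + y) * SP (Suc n) - cos (x + y) * SQ (Suc n)) + (sin (x - y) * SP i - cos (x - y) * SQ i)
        - 2 * cos y * (sin x * SP n - cos x * SQ n)"
      by (simp only: s\<kappa> \<theta> E)
    also have "\<dots> = SP i * (sin (x + y) + sin (x - y) - 2 * cos y * sin x)
        - SQ i * (cos (x + y) + cos (x - y) - 2 * cos y * cos x)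
        + P i * (sin (x + y) + sin (x - y) - 2 * cos y * sin x) - P i * sin (x - y)
        - Q i * (cos (x + y) + cos (x - y) - 2 * cos y * cos x) + Q i * cos (x - y)
        + (sin (x + y) * P n - cos (x + y) * Q n)"
      unfolding S by (simp add: algebra_simps)
    also have "\<dots> = f n * (sin (x + y) * cos x - cos (x + y) * sin x)"
      unfolding e1 PQ by (simp add: algebra_simps)
    also have "\<dots> = s * f n" unfolding e2 s' by simp
    finally show ?thesis using s by simp
  qed
  \<comment> \<open>An odd multiple of \<open>pi / q\<close> is never a multiple of
    \<open>pi\<close> when \<open>q\<close> is even.\<close>
  have sin2: "sin (2 * \<theta> n) \<noteq> 0" for n
  proof
    assume "sin (2 * \<theta> n) = 0"
    then obtain i :: int where "2 * \<theta> n = of_int i * pi" by (auto simp: sin_zero_iff_int2)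
    moreover have "2 * \<theta> n = (1 + 2 * real p * real n) / real q * pi"
      using q by (simp add: \<theta>_def k_def field_simps)
    ultimately have "(1 + 2 * real p * real n) / real q = of_int i"
      using pi_neq_zero by (metis mult_right_cancel)
    then have "real_of_int (1 + 2 * int p * int n) = real_of_int (i * int q)"
      using q by (simp add: field_simps)
    then have "1 + 2 * int p * int n = i * int q" by (simp only: of_int_eq_iff)
    moreover have "even (i * int q)" using q by simp
    moreover have "odd (1 + 2 * int p * int n)" by simp
    ultimately show False by metis
  qed
  have sin\<theta>: "sin (\<theta> n) \<noteq> 0" for n using sin2[of n] by (auto simp: sin_double)
  have \<sigma>: "\<bar>\<sigma> n\<bar> = 1" for n using sin2[of n] by (simp add: \<sigma>_def abs_sgn_eq)
  \<comment> \<open>By periodicity, nonvanishing of the sine becomes the uniform lower bound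
    \<open>1 / M\<close>; it keeps the factor \<open>a n\<close> below away from 0.\<close>
  define M where "M = (\<Sum>r<q. \<bar>1 / sin (\<theta> r)\<bar>)"
  have M: "\<bar>1 / sin (\<theta> n)\<bar> \<le> M" for n
  proof -
    have "\<bar>\<bar>1 / sin (\<theta> n)\<bar>\<bar> \<le> (\<Sum>r<q. \<bar>\<bar>1 / sin (\<theta> r)\<bar>\<bar>)"
    proof (rule bounded_periodic[OF _ q(2)])
      fix n
      have "\<theta> (n + q) = \<theta> n + real p * pi" using q(2) by (simp add: \<theta>_def k_def distrib_left)
      then have "\<bar>sin (\<theta> (n + q))\<bar> = \<bar>sin (\<theta> n)\<bar>"
        by (simp add: sin_add abs_mult)
      then show "\<bar>1 / sin (\<theta> (n + q))\<bar> = \<bar>1 / sin (\<theta> n)\<bar>" by simp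
    qed
    then show ?thesis by (simp add: M_def)
  qed
  have M_pos: "M > 0" using M[of 0] sin\<theta>[of 0] by (smt (verit) divide_eq_0_iff zero_less_abs_iff)
  have sin_ge: "\<bar>sin (\<theta> n)\<bar> \<ge> 1 / M" for n
    using M[of n] M_pos sin\<theta>[of n] by (simp add: field_simps)

  \<comment> \<open>The prescribed solution and its potential\<close>
  define a where "a n = sin (\<theta> n) + \<kappa> n / real n" for n
  define T where "T x = 1 / (sqrt x * ln x)" for x :: real
  define u where "u n = a n * T (real n)" for n
  have "(\<lambda>n. K / real n) \<longlonglongrightarrow> 0" by real_asymp
  then have "\<forall>\<^sub>F n in sequentially. K / real n < 1 / (2 * M)"
    using M_pos by (intro order_tendstoD) auto
  then have a_ge: "\<forall>\<^sub>F n in sequentially. \<bar>a n\<bar> \<ge> 1 / (2 * M)"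
  proof eventually_elim
    case (elim n)
    have "\<bar>\<kappa> n / real n\<bar> \<le> K / real n" using \<kappa>[of n] by (simp add: divide_right_mono)
    moreover have "1 / M = 1 / (2 * M) + 1 / (2 * M)" by simp
    ultimately show ?case using elim sin_ge[of n] unfolding a_def by linarith
  qed
  have T_pos: "T (real n) > 0" if "n \<ge> 2" for n using that by (simp add: T_def)
  have u_nz: "\<forall>\<^sub>F n in sequentially. u n \<noteq> 0"
    using a_ge eventually_ge_at_top[of 2]
  proof eventually_elim
    case (elim n)
    have "1 / (2 * M) > 0" using M_pos by simp
    with elim(1) have "a n \<noteq> 0" by auto
    with T_pos[OF elim(2)] show ?case by (simp add: u_def)
  qed
  have u_sum: "summable (\<lambda>n. (u n)\<^sup>2)"
  proof (rule summable_comparison_test_ev)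
    show "summable (\<lambda>n. (1 + K)\<^sup>2 * (1 / (real n * (ln (real n))\<^sup>2)))"
      by (intro summable_mult summable_inverse_n_ln_squared)
    show "\<forall>\<^sub>F n in sequentially. norm ((u n)\<^sup>2) \<le> (1 + K)\<^sup>2 * (1 / (real n * (ln (real n))\<^sup>2))"
      using eventually_ge_at_top[of 1]
    proof eventually_elim
      case (elim n)
      have "\<bar>\<kappa> n / real n\<bar> \<le> K / 1" unfolding abs_divide using elim \<kappa>[of n] K by (intro frac_le) auto
      then have "\<bar>a n\<bar> \<le> 1 + K"
        unfolding a_def using abs_sin_le_one[of "\<theta> n"] by linarith
      then have "(a n)\<^sup>2 \<le> (1 + K)\<^sup>2" by (rule power2_le_iff_abs_le[THEN iffD2, rotated]) (use K in auto)
      moreover have "(T (real n))\<^sup>2 = 1 / (real n * (ln (real n))\<^sup>2)"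
        by (simp add: T_def power_divide power_mult_distrib)
      ultimately have "(u n)\<^sup>2 \<le> (1 + K)\<^sup>2 * (1 / (real n * (ln (real n))\<^sup>2))"
        unfolding u_def power_mult_distrib by (simp only:) (intro mult_right_mono, auto)
      then show ?case by simp
    qed
  qed
  \<comment> \<open>The four errors of replacing the scaled envelope differences by
    \<open>1 / 2\<close> and \<open>- 1 / 2\<close>, and the envelope ratios multiplying \<kappa> by
    1.\<close>
  define \<alpha> where "\<alpha> x = x * (1 - T (x + 1) / T x) - 1 / 2" for x :: real
  define \<beta> where "\<beta> x = x * (1 - T (x - 1) / T x) + 1 / 2" for x :: real
  define \<gamma> where "\<gamma> x = 1 - T (x + 1) / T x * (x / (x + 1))" for x :: real
  define \<delta> where "\<delta> x = 1 - T (x - 1) / T x * (x / (x - 1))" for x :: real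
  have lims: "(\<lambda>n. \<alpha> (real n)) \<longlonglongrightarrow> 0" "(\<lambda>n. \<beta> (real n)) \<longlonglongrightarrow> 0"
    "(\<lambda>n. \<gamma> (real n)) \<longlonglongrightarrow> 0" "(\<lambda>n. \<delta> (real n)) \<longlonglongrightarrow> 0"
  proof -
    show "(\<lambda>n. \<alpha> (real n)) \<longlonglongrightarrow> 0"
      using tendsto_diff[OF scaled_ratio_tendsto(1) tendsto_const[of "1 / 2"]]
      unfolding \<alpha>_def T_def by simp
    show "(\<lambda>n. \<beta> (real n)) \<longlonglongrightarrow> 0"
      using tendsto_add[OF scaled_ratio_tendsto(2) tendsto_const[of "1 / 2"]]
      unfolding \<beta>_def T_def by simp
    show "(\<lambda>n. \<gamma> (real n)) \<longlonglongrightarrow> 0" unfolding \<gamma>_def T_def by real_asymp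
    show "(\<lambda>n. \<delta> (real n)) \<longlonglongrightarrow> 0" unfolding \<delta>_def T_def by real_asymp
  qed
  define W where "W n = E - (u (n + 1) + u (n - 1)) / u n" for n
  \<comment> \<open>Division by \<open>a n\<close>, whose absolute value is at least
    \<open>1 / (2 * M)\<close>, produces the last factor.\<close>
  define b where "b n = (\<bar>\<alpha> (real n)\<bar> + \<bar>\<beta> (real n)\<bar> + K * \<bar>\<gamma> (real n)\<bar> + K * \<bar>\<delta> (real n)\<bar>
      + C * (K / real n)) * (2 * M)" for n
  have b0: "b \<longlonglongrightarrow> 0"
  proof -
    have "b \<longlonglongrightarrow> (\<bar>0\<bar> + \<bar>0\<bar> + K * \<bar>0\<bar> + K * \<bar>0\<bar> + C * 0) * (2 * M)"
      unfolding b_def by (intro tendsto_intros tendsto_rabs lims \<open>(\<lambda>n. K / real n) \<longlonglongrightarrow> 0\<close>)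
    then show ?thesis by simp
  qed
  have close: "\<forall>\<^sub>F n in sequentially. \<bar>real n * W n - C * \<sigma> n\<bar> \<le> b n"
    using a_ge eventually_ge_at_top[of 3]
  proof eventually_elim
    case (elim n)
    have "1 / (2 * M) > 0" using M_pos by simp
    with elim(1) have a_nz: "a n \<noteq> 0" by auto
    have T_nz: "T (real n) \<noteq> 0" using T_pos[of n] elim(2) by simp
    define rp rm where "rp = T (real n + 1) / T (real n)" and "rm = T (real n - 1) / T (real n)"
    have n1: "real (n + 1) = real n + 1" "real (n - 1) = real n - 1" using elim(2) by auto
    have W_a: "W n * a n = E * a n - rp * a (n + 1) - rm * a (n - 1)"
    proof -
      have "W n * u n = E * u n - u (n + 1) - u (n - 1)"
        using a_nz T_nz by (simp add: W_def u_def field_simps)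
      then have "W n * a n * T (real n) = E * a n * T (real n) - a (n + 1) * T (real n + 1) - a (n - 1) * T (real n - 1)"
        by (simp only: u_def n1 mult.assoc)
      then have "W n * a n = (E * a n * T (real n) - a (n + 1) * T (real n + 1) - a (n - 1) * T (real n - 1)) / T (real n)"
        using T_nz by (simp add: eq_divide_eq)
      also have "\<dots> = E * a n - rp * a (n + 1) - rm * a (n - 1)"
        using T_nz by (simp add: rp_def rm_def diff_divide_distrib mult.commute)
      finally show ?thesis .
    qed
    have trig: "E * sin (\<theta> n) = sin (\<theta> (n + 1)) + sin (\<theta> (n - 1))"
      "2 * s * cos (\<theta> n) = sin (\<theta> (n + 1)) - sin (\<theta> (n - 1))"
    proof -
      obtain i where n: "n = Suc i" using elim(2) by (cases n) auto
      have "\<theta> i = \<theta> n - pi * k" "\<theta> (n + 1) = \<theta> n + pi * k" by (simp_all add: n \<theta>_Suc)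
      then show "E * sin (\<theta> n) = sin (\<theta> (n + 1)) + sin (\<theta> (n - 1))"
        "2 * s * cos (\<theta> n) = sin (\<theta> (n + 1)) - sin (\<theta> (n - 1))"
        by (simp_all add: n E_def s_def sin_add sin_diff)
    qed
    define D where "D = \<alpha> (real n) * sin (\<theta> (n + 1)) + \<beta> (real n) * sin (\<theta> (n - 1))
        + \<kappa> (n + 1) * \<gamma> (real n) + \<kappa> (n - 1) * \<delta> (real n)"
    have na: "real n * a n = real n * sin (\<theta> n) + \<kappa> n"
      using elim(2) by (simp add: a_def distrib_left)
    have ap: "a (n + 1) = sin (\<theta> (n + 1)) + \<kappa> (n + 1) / (real n + 1)"
      "a (n - 1) = sin (\<theta> (n - 1)) + \<kappa> (n - 1) / (real n - 1)" by (simp_all only: a_def n1)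
    have "real n * (W n * a n) = E * (real n * a n) - real n * rp * a (n + 1) - real n * rm * a (n - 1)"
      unfolding W_a by (simp add: algebra_simps)
    also have "\<dots> = real n * (E * sin (\<theta> n)) + E * \<kappa> n
        - real n * rp * sin (\<theta> (n + 1)) - real n * rm * sin (\<theta> (n - 1))
        - \<kappa> (n + 1) * (rp * (real n / (real n + 1))) - \<kappa> (n - 1) * (rm * (real n / (real n - 1)))"
      unfolding na ap by (simp add: distrib_left mult_ac)
    \<comment> \<open>The limits \<open>1 / 2\<close> and \<open>- 1 / 2\<close> leave half the
      difference of neighbouring sines, which is \<open>s * cos (\<theta> n)\<close>; subtracting
      the forcing \<open>f n\<close> then leaves exactly
      \<open>C * \<sigma> n * sin (\<theta> n)\<close>.\<close>
    also have "\<dots> = D + (sin (\<theta> (n + 1)) - sin (\<theta> (n - 1))) / 2 - (\<kappa> (n + 1) + \<kappa> (n - 1) - E * \<kappa> n)"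
      unfolding trig(1) D_def \<alpha>_def \<beta>_def \<gamma>_def \<delta>_def rp_def[symmetric] rm_def[symmetric]
      by (simp add: algebra_simps diff_divide_distrib)
    also have "\<dots> = D + s * cos (\<theta> n) - f n"
      using trig(2) \<kappa>_rec[of n] elim(2) by simp
    also have "\<dots> = D + C * \<sigma> n * sin (\<theta> n)" by (simp add: f_def)
    finally have "(real n * W n - C * \<sigma> n) * a n = D - C * \<sigma> n * (\<kappa> n / real n)"
      by (simp add: a_def algebra_simps)
    then have "\<bar>real n * W n - C * \<sigma> n\<bar> * \<bar>a n\<bar> = \<bar>D - C * \<sigma> n * (\<kappa> n / real n)\<bar>"
      by (simp add: abs_mult[symmetric])
    also have "\<dots> \<le> \<bar>D\<bar> + \<bar>C * \<sigma> n * (\<kappa> n / real n)\<bar>" by (rule abs_triangle_ineq4)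
    also have "\<bar>C * \<sigma> n * (\<kappa> n / real n)\<bar> \<le> C * (K / real n)"
      using C \<kappa>[of n] by (simp add: abs_mult \<sigma> mult_left_mono divide_right_mono)
    also have "\<bar>D\<bar> \<le> \<bar>\<alpha> (real n)\<bar> * 1 + \<bar>\<beta> (real n)\<bar> * 1 + K * \<bar>\<gamma> (real n)\<bar> + K * \<bar>\<delta> (real n)\<bar>"
      unfolding D_def using \<kappa> K
      by (intro order.trans[OF abs_triangle_ineq] add_mono) (auto simp: abs_mult intro!: mult_mono mult_left_le)
    finally have le: "\<bar>real n * W n - C * \<sigma> n\<bar> * \<bar>a n\<bar> \<le> b n / (2 * M)"
      using M_pos by (simp add: b_def)
    have "\<bar>real n * W n - C * \<sigma> n\<bar> * (1 / (2 * M)) \<le> \<bar>real n * W n - C * \<sigma> n\<bar> * \<bar>a n\<bar>"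
      using elim(1) by (intro mult_left_mono) auto
    with le show ?case using M_pos by (simp add: field_simps)
  qed
  have "(\<lambda>n. \<bar>real n * W n\<bar> - C) \<longlonglongrightarrow> 0"
  proof (rule Lim_null_comparison[OF _ b0])
    show "\<forall>\<^sub>F n in sequentially. norm (\<bar>real n * W n\<bar> - C) \<le> b n"
      using close
    proof eventually_elim
      case (elim n)
      have "\<bar>C * \<sigma> n\<bar> = C" using C by (simp add: abs_mult \<sigma>)
      then show ?case using elim by simp
    qed
  qed
  then have "(\<lambda>n. \<bar>real n * W n\<bar>) \<longlonglongrightarrow> C" by (simp add: LIM_zero_iff)
  from eigenvalue_of_nonvanishing_tail[OF u_nz u_sum this[unfolded W_def]]
  show ?thesis by (simp add: C_def s_def E_def)
qed

section \<open>Existence of the critical potential\<close>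

text \<open>Injectivity of the cosine on \<open>[0, pi]\<close> identifies \<open>k\<close> from
  \<open>E\<close>: irrational for \<open>q = 0\<close>, otherwise a reduced fraction with
  denominator \<open>q\<close>. The irrational and odd cases use the phase-uniform mean, the even
  case a prescribed solution.\<close>

lemma critical_potential:
  fixes q :: nat and k E \<phi> :: real
  assumes "q = 0 \<or> q \<ge> 2"
    and "0 < k" and "k < 1"
    and "E = 2 * cos (pi * k)"
    and "E \<in> energy_set q"
  shows "\<exists>V. (\<lambda>n. \<bar>real n * V n\<bar>) \<longlonglongrightarrow> critical_const q k \<and> is_eigenvalue V \<phi> E"
proof -
  have inj: "x = k" if "0 < x" "x < 1" "E = 2 * cos (pi * x)" for x
  proof -
    have "pi * x \<le> pi * 1" "pi * k \<le> pi * 1"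
      using that assms(3) by (intro mult_left_mono; simp)+
    moreover have "cos (pi * x) = cos (pi * k)" using that(3) assms(4) by simp
    ultimately have "pi * x = pi * k"
      using that(1) assms(2) by - (rule cos_inj_pi, simp_all)
    then show ?thesis by simp
  qed
  show ?thesis
  proof (cases "q = 0")
    case True
    then have "k \<notin> \<rat>" using assms(5) inj by (auto simp: energy_set_def)
    then show ?thesis
      using greedy_eigenvalue[OF assms(2,3), of "2 / pi" \<phi>] uniform_average_abs_sin[of k] True assms(4)
      by (simp add: critical_const_def A_const_def)
  next
    case False
    with assms(1) have q: "q \<ge> 2" by simp
    obtain p where p: "1 \<le> p" "p \<le> q - 1" "gcd p q = 1" "E = 2 * cos (pi * (real p / real q))"
      using assms(5) False by (auto simp: energy_set_def)
    have pq: "0 < p" "p < q" using p(1,2) q by auto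
    have cop: "coprime p q" using p(3) by (simp only: coprime_iff_gcd_eq_1)
    have k: "k = real p / real q"
      using inj[of "real p / real q"] pq p(4) by simp
    show ?thesis
    proof (cases "even q")
      case True
      have "sin (pi * k) * (real q * sin (pi / real q)) / 2 = critical_const q k"
        using True False by (simp add: critical_const_def A_const_def)
      with even_eigenvalue[OF True _ cop pq, of \<phi>] q show ?thesis
        by (simp add: k[symmetric] assms(4))
    next
      case odd: False
      define x where "x = pi / (2 * real q)"
      have x: "0 < x" "x < pi / 2" "pi / real q = 2 * x" using q by (auto simp: x_def field_simps)
      have sx: "sin x > 0" "cos x > 0"
        using x by (auto intro!: sin_gt_zero2 cos_gt_zero)
      \<comment> \<open>The half-angle formula turns \<open>B_const q\<close> into the grid bound of
        \<open>sum_abs_sin_coprime_ge\<close> divided by \<open>q\<close>.\<close>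
      have B: "B_const q = cot x / real q"
      proof -
        have "1 + cos (2 * x) = 2 * cos x * cos x" by (simp add: cos_double_cos power2_eq_square)
        then show ?thesis using sx q
          unfolding B_const_def x(3) sin_double by (simp add: cot_def field_simps)
      qed
      have B_pos: "B_const q > 0" using sx q by (simp add: B cot_def)
      have avg: "\<exists>L>0. \<forall>y. (\<Sum>j<L. \<bar>sin (y + 2 * pi * k * real j)\<bar>) \<ge> real L * (B_const q - \<eta>)"
        if "\<eta> > 0" for \<eta>
      proof (intro exI[of _ q] conjI allI)
        fix y
        \<comment> \<open>For odd \<open>q\<close> the doubled numerator \<open>2 * p\<close>
          remains coprime to \<open>q\<close>, so the doubled phases fill the whole grid of spacing
          \<open>pi / q\<close> modulo \<open>pi\<close>, and one period serves as the
          window.\<close>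
        have "coprime (int (2 * p)) (int q)"
          using cop odd unfolding coprime_int_iff by (simp add: coprime_mult_left_iff coprime_left_2_iff_odd)
        then have "cot x \<le> (\<Sum>j<q. \<bar>sin (y + pi * (of_int (int (2 * p)) * real j / real q))\<bar>)"
          using q unfolding x_def by (intro sum_abs_sin_coprime_ge) auto
        also have "\<dots> = (\<Sum>j<q. \<bar>sin (y + 2 * pi * k * real j)\<bar>)"
          by (intro sum.cong refl) (simp add: k mult_ac)
        finally have "cot x \<le> (\<Sum>j<q. \<bar>sin (y + 2 * pi * k * real j)\<bar>)" .
        moreover have "real q * (B_const q - \<eta>) \<le> real q * B_const q"
          using that by (intro mult_left_mono) auto
        moreover have "real q * B_const q = cot x" using q by (simp add: B)
        ultimately show "real q * (B_const q - \<eta>) \<le> (\<Sum>j<q. \<bar>sin (y + 2 * pi * k * real j)\<bar>)" by simp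
      qed (use q in simp)
      from greedy_eigenvalue[OF assms(2,3) B_pos avg, of \<phi>] odd show ?thesis
        by (simp add: critical_const_def assms(4))
    qed
  qed
qed

theorem theorem1p4:
  fixes q :: nat and k E \<phi> :: real
  assumes "q = 0 \<or> q \<ge> 2"
    and "0 < k" and "k < 1"
    and "E = 2 * cos (pi * k)"
    and "E \<in> energy_set q"
  shows "\<exists>V :: nat \<Rightarrow> real.
           V \<in> O(\<lambda>n. 1 / (1 + real n)) \<and>
           limsup (\<lambda>n. ereal \<bar>real n * V n\<bar>) = ereal (critical_const q k) \<and>
           is_eigenvalue V \<phi> E"
  using critical_potential[OF assms, of \<phi>] bigo_limsup_of_scaled_limit by blast

end
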